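(* Let $K=\mathbb{F}_q$ be a finite field, let $s\geq 2$, let $\mathcal{X}=[A_1\times\cdots\times A_s]\subset\mathbb{P}^{s-1}$ be a projective nested cartesian set over $K$, and let $d_i=|A_i|$ for $i=1,\ldots,s$. Let $f\in S=K[t_1,\ldots,t_s]$ be a homogeneous polynomial of degree $d$ that does not vanish at all points of $\mathcal{X}$ (i.e., $f$ is non-zero at some point of $\mathcal{X}$). If $d=\sum_{i=2}^{s-1}(d_i-1)+\ell$ with $\ell$ an integer, $1\leq \ell\leq d_1-1$, then $$|V_\mathcal{X}(f)|\leq\deg(S/I(\mathcal{X}))-(d_1-\ell+1).$$ In particular, $\delta_\mathcal{X}(d,1)\geq d_1-\ell+1\geq 2$.
   Context: For subsets $A_1,\ldots,A_s$ of $K$, $[A_1\times\cdots\times A_s]$ denotes the image of $(A_1\times\cdots\times A_s)\setminus\{0\}$ under $K^s\setminus\{0\}\to\mathbb{P}^{s-1}$, $x\mapsto[x]$. It is called a projective nested cartesian set if: (i) $\{0,1\}\subset A_i$ for all $i$; (ii) $a/b\in A_j$ whenever $1\leq i<j\leq s$, $a\in A_j$, $0\neq b\in A_i$; (iii) $d_1\leq\cdots\leq d_s$, where $d_i=|A_i|$. $V_\mathcal{X}(f)$ is the set of $[\alpha]\in\mathcal{X}$ with $f(\alpha)=0$. $I(\mathcal{X})\subset S$ is the ideal generated by the homogeneous polynomials vanishing on $\mathcal{X}$, and $\deg(S/I(\mathcal{X}))$ is the degree (multiplicity) of the graded ring $S/I(\mathcal{X})$, namely $(k-1)!\lim_{e\to\infty}\dim_K(S/I(\mathcal{X}))_e/e^{k-1}$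 with $k=\dim (S/I(\mathcal{X}))\ge 1$; it equals $|\mathcal{X}|$. Writing $\mathcal{X}=\{[P_1],\ldots,[P_m]\}$, $m=|\mathcal{X}|$, with representatives $P_i$ whose first non-zero entry is $1$, $C_\mathcal{X}(d)$ is the image of $S_d\to K^m$, $f\mapsto(f(P_1),\ldots,f(P_m))$, and $\delta_\mathcal{X}(d,1)$ is its minimum distance, i.e. the least number of non-zero entries of a non-zero element of $C_\mathcal{X}(d)$. *)

theory Defs
  imports
    Complex_Main
    "HOL-Library.Poly_Mapping"
    "HOL-Library.Extended_Nat"
    "HOL-Algebra.QuotRing"
    "HOL-Algebra.Embedded_Algebras"
begin

section \<open>The polynomial ring in \<open>t\<^sub>1, \<dots>, t\<^sub>s\<close>\<close>

text \<open>A monomial is its exponent vector \<open>nat \<Rightarrow>\<^sub>0 nat\<close>, a polynomial the finitely supported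
  family of its coefficients.\<close>

type_synonym 'a mpoly = "(nat \<Rightarrow>\<^sub>0 nat) \<Rightarrow>\<^sub>0 'a"

definition poly_ring :: "nat \<Rightarrow> ('a::comm_ring_1) mpoly ring" where
  "poly_ring s =
    \<lparr>carrier = {p. \<forall>m\<in>Poly_Mapping.keys p. Poly_Mapping.keys m \<subseteq> {1..s}},
     mult = (*), one = 1, zero = 0, add = (+)\<rparr>"

definition poly_eval :: "('a::comm_ring_1) mpoly \<Rightarrow> (nat \<Rightarrow> 'a) \<Rightarrow> 'a" where
  "poly_eval f \<alpha> =
    (\<Sum>m\<in>Poly_Mapping.keys f. Poly_Mapping.lookup f m *
      (\<Prod>i\<in>Poly_Mapping.keys m. \<alpha> i ^ Poly_Mapping.lookup m i))"

definition monom_degree :: "(nat \<Rightarrow>\<^sub>0 nat) \<Rightarrow> nat" where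
  "monom_degree m = (\<Sum>i\<in>Poly_Mapping.keys m. Poly_Mapping.lookup m i)"

text \<open>The graded piece \<open>S\<^sub>e\<close>; it contains the zero polynomial for every \<open>e\<close>.\<close>

definition homogeneous_polys :: "nat \<Rightarrow> nat \<Rightarrow> ('a::comm_ring_1) mpoly set" where
  "homogeneous_polys s e =
    {p \<in> carrier (poly_ring s). \<forall>m\<in>Poly_Mapping.keys p. monom_degree m = e}"

section \<open>Degree of a graded quotient of the polynomial ring\<close>

definition krull_dim :: "('r, 'm) ring_scheme \<Rightarrow> enat" where
  "krull_dim R =
    Sup {enat n | n. \<exists>\<pp>. (\<forall>i\<le>n. primeideal (\<pp> i) R) \<and> (\<forall>i<n. \<pp> i \<subset> \<pp> (Suc i))}"

text \<open>\<open>dim\<^sub>K (S/I)\<^sub>e\<close>: both \<open>K\<close> and \<open>S\<^sub>e\<close> are replaced by their images in \<open>S/I\<close>. For proper \<open>I\<close>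
  the field \<open>K\<close> embeds into \<open>S/I\<close>.\<close>

definition hilbert_function :: "nat \<Rightarrow> ('a::field) mpoly set \<Rightarrow> nat \<Rightarrow> nat" where
  "hilbert_function s I e =
    ring.dim (poly_ring s Quot I)
      (range (\<lambda>c. I +>\<^bsub>poly_ring s\<^esub> Poly_Mapping.single 0 c))
      ((\<lambda>p. I +>\<^bsub>poly_ring s\<^esub> p) ` homogeneous_polys s e)"

definition quotient_degree :: "nat \<Rightarrow> ('a::field) mpoly set \<Rightarrow> real" where
  "quotient_degree s I =
    (let k = the_enat (krull_dim (poly_ring s Quot I))
     in fact (k - 1) * lim (\<lambda>e. real (hilbert_function s I e) / real e ^ (k - 1)))"

section \<open>Projective space and projective nested cartesian sets\<close>

text \<open>\<open>K\<^sup>s\<close> consists of the functions that vanish outside the index set \<open>{1..s}\<close>.\<close>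

definition affine_space :: "nat \<Rightarrow> (nat \<Rightarrow> 'a::zero) set" where
  "affine_space s = {x. \<forall>i. i \<notin> {1..s} \<longrightarrow> x i = 0}"

definition proportional :: "nat \<Rightarrow> ((nat \<Rightarrow> 'a::field) \<times> (nat \<Rightarrow> 'a)) set" where
  "proportional s =
    {(x, y). x \<in> affine_space s - {\<lambda>_. 0} \<and> y \<in> affine_space s - {\<lambda>_. 0} \<and>
      (\<exists>c. c \<noteq> 0 \<and> y = (\<lambda>i. c * x i))}"

definition projective_space :: "nat \<Rightarrow> (nat \<Rightarrow> 'a::field) set set" where
  "projective_space s = (affine_space s - {\<lambda>_. 0}) // proportional s"

definition proj_point :: "nat \<Rightarrow> (nat \<Rightarrow> 'a::field) \<Rightarrow> (nat \<Rightarrow> 'a) set" where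
  "proj_point s x = proportional s `` {x}"

definition projective_cartesian_set ::
    "nat \<Rightarrow> (nat \<Rightarrow> 'a::field set) \<Rightarrow> (nat \<Rightarrow> 'a) set set" where
  "projective_cartesian_set s A =
    proj_point s ` ({x \<in> affine_space s. \<forall>i\<in>{1..s}. x i \<in> A i} - {\<lambda>_. 0})"

lemma projective_cartesian_set_subset:
  "projective_cartesian_set s A \<subseteq> projective_space s"
  unfolding projective_cartesian_set_def projective_space_def proj_point_def
  by (auto intro: quotientI)

definition nested_cartesian :: "nat \<Rightarrow> (nat \<Rightarrow> 'a::field set) \<Rightarrow> bool" where
  "nested_cartesian s A \<longleftrightarrow>
    (\<forall>i\<in>{1..s}. {0, 1} \<subseteq> A i) \<and>
    (\<forall>i j a b. 1 \<le> i \<and> i < j \<and> j \<le> s \<and> a \<in> A j \<and> b \<in> A i \<and> b \<noteq> 0 \<longrightarrow> a / b \<in> A j) \<and>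
    (\<forall>i j. 1 \<le> i \<and> i \<le> j \<and> j \<le> s \<longrightarrow> card (A i) \<le> card (A j))"

section \<open>Zeros, vanishing ideal, and evaluation codes\<close>

text \<open>For homogeneous \<open>f\<close> the condition \<open>f \<alpha> = 0\<close> does not depend on the representative \<open>\<alpha>\<close>.\<close>

definition zero_set ::
    "(nat \<Rightarrow> 'a::field) set set \<Rightarrow> 'a mpoly \<Rightarrow> (nat \<Rightarrow> 'a) set set" where
  "zero_set X f = {P \<in> X. \<forall>\<alpha>\<in>P. poly_eval f \<alpha> = 0}"

definition vanishing_ideal ::
    "nat \<Rightarrow> (nat \<Rightarrow> 'a::field) set set \<Rightarrow> 'a mpoly set" where
  "vanishing_ideal s X =
    Idl\<^bsub>poly_ring s\<^esub> {f. (\<exists>e. f \<in> homogeneous_polys s e) \<and> zero_set X f = X}"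

text \<open>The representative whose first non-zero entry is 1.\<close>

definition standard_rep :: "(nat \<Rightarrow> 'a::field) set \<Rightarrow> nat \<Rightarrow> 'a" where
  "standard_rep P = (THE \<alpha>. \<alpha> \<in> P \<and> (\<exists>i. \<alpha> i = 1 \<and> (\<forall>j<i. \<alpha> j = 0)))"

text \<open>The coordinates of a codeword are indexed by the points of \<open>X\<close> themselves instead of by an
  enumeration of \<open>X\<close>; codewords are extended by 0 outside \<open>X\<close>.\<close>

definition evaluation_code ::
    "nat \<Rightarrow> (nat \<Rightarrow> 'a::field) set set \<Rightarrow> nat \<Rightarrow> ((nat \<Rightarrow> 'a) set \<Rightarrow> 'a) set" where
  "evaluation_code s X d =
    (\<lambda>f P. if P \<in> X then poly_eval f (standard_rep P) else 0) ` homogeneous_polys s d"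

definition min_distance :: "('p \<Rightarrow> 'a::zero) set \<Rightarrow> nat" where
  "min_distance C = Inf {card {P. c P \<noteq> 0} | c. c \<in> C \<and> c \<noteq> (\<lambda>_. 0)}"

end

theory Submission
  imports Defs "HOL-Computational_Algebra.Polynomial"
begin

text \<open>
  The bound says that a form \<open>f\<close> of degree \<open>d\<close> that is not zero on all of \<open>X\<close> is non-zero at at
  least \<open>d\<^sub>1 - l + 1\<close> points of \<open>X\<close>, once the degree of \<open>S/I(X)\<close> is known to be \<open>|X|\<close>.  Those are the
  two parts of the proof.

  Counting (\<open>card_nonzeros_lower_bound\<close>).  Let \<open>m\<close> be the number of points of \<open>X\<close> where \<open>f\<close> is
  non-zero and let \<open>P\<close> be one of them.  Multiply \<open>f\<close> by \<open>m - 1\<close> linear forms, each of which is zero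
  at one of the other \<open>m - 1\<close> points and non-zero at \<open>P\<close>.  The product is a form of positive degree
  \<open>d + m - 1\<close>, so it is zero at the origin, and on the affine grid \<open>A\<^sub>1 \<times> \<dots> \<times> A\<^sub>s\<close> it is non-zero only
  at representatives of \<open>P\<close>.  If \<open>x\<close> is one of them and \<open>x\<^sub>i \<noteq> 0\<close>, replace the side \<open>A\<^sub>i\<close> by
  \<open>{0, x\<^sub>i}\<close>: on the smaller grid only \<open>x\<close> itself remains.  A polynomial that is non-zero at exactly
  one point of a grid has degree at least the sum, over all sides, of their sizes minus one
  (\<open>punctured_grid\<close>, proved by pairing with the product of Lagrange weights).  With \<open>d\<^sub>j = |A\<^sub>j|\<close> this
  reads \<open>d + m - 1 \<ge> \<Sum>\<^bsub>j \<noteq> i\<^esub> (d\<^sub>j - 1) + 1\<close>, and the right-hand side is smallest for \<open>i = s\<close>.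
  Inserting the value of \<open>d\<close> gives \<open>m \<ge> d\<^sub>1 - l + 1\<close>.  The codeword of \<open>f\<close> has exactly \<open>m\<close> non-zero
  entries, so this is also the bound on the minimum distance.

  The degree (\<open>quotient_degree_points\<close>).  For \<open>e \<ge> |X|\<close> each point of \<open>X\<close> has a form of degree \<open>e\<close>
  that is non-zero there and zero on the rest of \<open>X\<close>, so evaluation identifies the graded piece
  \<open>(S/I)\<^sub>e\<close> with \<open>K\<^sup>X\<close> and the Hilbert function is \<open>|X|\<close> (\<open>hilbert_function_points\<close>).  It remains to see
  that \<open>S/I\<close> has Krull dimension one (\<open>krull_dim_points\<close>).  Since \<open>K\<close> is finite, the forms
  \<open>t\<^sub>i \<Prod>\<^sub>c (t\<^sub>j - c t\<^sub>i)\<close> lie in \<open>I\<close>; modulo a prime above \<open>I\<close> all variables therefore become multiples of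
  one element \<open>T\<close>, and every polynomial becomes a univariate one in \<open>T\<close>.  In the quotient by a
  strictly larger prime \<open>T\<close> satisfies an equation, so the powers of each element repeat and a
  non-zero element is a unit: the larger prime is maximal.  The line through a point of \<open>X\<close> and the
  origin provide a chain of two primes.
\<close>

section \<open>Evaluation as a ring homomorphism\<close>

definition monom_value :: "(nat \<Rightarrow> 'b::comm_ring_1) \<Rightarrow> (nat \<Rightarrow>\<^sub>0 nat) \<Rightarrow> 'b" where
  "monom_value \<alpha> m = (\<Prod>i\<in>Poly_Mapping.keys m. \<alpha> i ^ Poly_Mapping.lookup m i)"

text \<open>Evaluation in an arbitrary commutative ring, the coefficients being transported along \<open>h\<close>.
  Besides values at points, this covers the restriction of a polynomial to the line through a
  point, where the target is the univariate polynomial ring.\<close>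
definition hom_eval ::
    "('a::comm_ring_1 \<Rightarrow> 'b::comm_ring_1) \<Rightarrow> (nat \<Rightarrow> 'b) \<Rightarrow> 'a mpoly \<Rightarrow> 'b" where
  "hom_eval h \<alpha> f =
    (\<Sum>m\<in>Poly_Mapping.keys f. h (Poly_Mapping.lookup f m) * monom_value \<alpha> m)"

definition coeff_hom :: "('a::comm_ring_1 \<Rightarrow> 'b::comm_ring_1) \<Rightarrow> bool" where
  "coeff_hom h \<longleftrightarrow>
    h 1 = 1 \<and> (\<forall>a b. h (a + b) = h a + h b) \<and> (\<forall>a b. h (a * b) = h a * h b)"

lemma coeff_homD:
  assumes "coeff_hom h"
  shows "h 1 = 1" "h (a + b) = h a + h b" "h (a * b) = h a * h b" "h 0 = 0"
proof -
  show "h 1 = 1" "h (a * b) = h a * h b" and add: "h (a + b) = h a + h b" for a b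
    using assms by (auto simp: coeff_hom_def)
  show "h 0 = 0" using add[of 0 0] by simp
qed

lemma coeff_hom_id: "coeff_hom (\<lambda>c. c)"
  by (simp add: coeff_hom_def)

lemma poly_eval_hom_eval: "poly_eval f \<alpha> = hom_eval (\<lambda>c. c) \<alpha> f"
  by (simp add: poly_eval_def hom_eval_def monom_value_def)

lemma monom_value_superset:
  assumes "finite S" "Poly_Mapping.keys m \<subseteq> S"
  shows "monom_value \<alpha> m = (\<Prod>i\<in>S. \<alpha> i ^ Poly_Mapping.lookup m i)"
  unfolding monom_value_def using assms
  by (intro prod.mono_neutral_left) (auto simp: in_keys_iff)

lemma monom_value_0 [simp]: "monom_value \<alpha> 0 = 1"
  by (simp add: monom_value_def)

lemma monom_value_add: "monom_value \<alpha> (m + n) = monom_value \<alpha> m * monom_value \<alpha> n"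
proof -
  let ?S = "Poly_Mapping.keys m \<union> Poly_Mapping.keys n"
  have "Poly_Mapping.keys (m + n) \<subseteq> ?S" by (rule Poly_Mapping.keys_add)
  then show ?thesis
    by (subst (1 2 3) monom_value_superset[of ?S])
      (auto simp: lookup_add power_add prod.distrib)
qed

lemma monom_value_single [simp]: "monom_value \<alpha> (Poly_Mapping.single i k) = \<alpha> i ^ k"
  by (cases "k = 0") (simp_all add: monom_value_def)

lemma monom_degree_add: "monom_degree (m + n) = monom_degree m + monom_degree n"
  unfolding monom_degree_def
  by (rule setsum_keys_plus_distrib[where f = "\<lambda>_ x. x"]) simp_all

lemma monom_degree_single [simp]: "monom_degree (Poly_Mapping.single i k) = k"
  by (cases "k = 0") (simp_all add: monom_degree_def)

lemma monom_degree_0 [simp]: "monom_degree 0 = 0"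
  by (simp add: monom_degree_def)

lemma monom_value_scale: "monom_value (\<lambda>i. c * x i) m = c ^ monom_degree m * monom_value x m"
  by (simp add: monom_value_def monom_degree_def power_mult_distrib prod.distrib power_sum)

lemma hom_eval_add:
  assumes "coeff_hom h"
  shows "hom_eval h \<alpha> (f + g) = hom_eval h \<alpha> f + hom_eval h \<alpha> g"
  unfolding hom_eval_def
  by (rule setsum_keys_plus_distrib[where f = "\<lambda>m c. h c * monom_value \<alpha> m"])
    (simp_all add: coeff_homD[OF assms] algebra_simps)

lemma hom_eval_0 [simp]: "hom_eval h \<alpha> 0 = 0"
  by (simp add: hom_eval_def)

lemma hom_eval_sum:
  assumes "coeff_hom h"
  shows "hom_eval h \<alpha> (\<Sum>x\<in>S. F x) = (\<Sum>x\<in>S. hom_eval h \<alpha> (F x))"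
  by (induction S rule: infinite_finite_induct) (simp_all add: hom_eval_add[OF assms])

lemma hom_eval_single:
  assumes "coeff_hom h"
  shows "hom_eval h \<alpha> (Poly_Mapping.single m c) = h c * monom_value \<alpha> m"
  by (cases "c = 0") (simp_all add: hom_eval_def coeff_homD[OF assms])

lemma mpoly_sum_monomials:
  "f = (\<Sum>m\<in>Poly_Mapping.keys f. Poly_Mapping.single m (Poly_Mapping.lookup f m))"
proof (rule poly_mapping_eqI)
  fix k
  show "Poly_Mapping.lookup f k = Poly_Mapping.lookup
      (\<Sum>m\<in>Poly_Mapping.keys f. Poly_Mapping.single m (Poly_Mapping.lookup f m)) k"
    by (simp add: lookup_sum lookup_single when_def in_keys_iff)
qed

lemma hom_eval_mult:
  assumes "coeff_hom h"
  shows "hom_eval h \<alpha> (f * g) = hom_eval h \<alpha> f * hom_eval h \<alpha> g"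
proof -
  let ?s = "\<lambda>f m. Poly_Mapping.single m (Poly_Mapping.lookup f m)"
  have "f * g = (\<Sum>m\<in>Poly_Mapping.keys f. ?s f m) * (\<Sum>n\<in>Poly_Mapping.keys g. ?s g n)"
    using mpoly_sum_monomials[of f] mpoly_sum_monomials[of g] by simp
  also have "\<dots> = (\<Sum>m\<in>Poly_Mapping.keys f. \<Sum>n\<in>Poly_Mapping.keys g. ?s f m * ?s g n)"
    by (rule sum_product)
  finally have "hom_eval h \<alpha> (f * g) =
      (\<Sum>m\<in>Poly_Mapping.keys f. \<Sum>n\<in>Poly_Mapping.keys g. hom_eval h \<alpha> (?s f m * ?s g n))"
    by (simp add: hom_eval_sum[OF assms])
  also have "\<dots> = (\<Sum>m\<in>Poly_Mapping.keys f. \<Sum>n\<in>Poly_Mapping.keys g.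
      (h (Poly_Mapping.lookup f m) * monom_value \<alpha> m) *
      (h (Poly_Mapping.lookup g n) * monom_value \<alpha> n))"
    by (simp add: mult_single hom_eval_single[OF assms] monom_value_add coeff_homD[OF assms]
        mult_ac)
  also have "\<dots> = hom_eval h \<alpha> f * hom_eval h \<alpha> g"
    by (simp add: hom_eval_def sum_product)
  finally show ?thesis .
qed

lemma hom_eval_1 [simp]: "coeff_hom h \<Longrightarrow> hom_eval h \<alpha> 1 = 1"
  using hom_eval_single[of h \<alpha> 0 1] by (simp add: coeff_homD)

lemma hom_eval_map:
  assumes "coeff_hom h"
  shows "hom_eval h (\<lambda>i. h (x i)) f = h (poly_eval f x)"
proof -
  have sum: "h (\<Sum>x\<in>S. F x) = (\<Sum>x\<in>S. h (F x))" for S :: "(nat \<Rightarrow>\<^sub>0 nat) set" and F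
    by (induction S rule: infinite_finite_induct) (simp_all add: coeff_homD[OF assms])
  have prod: "h (\<Prod>x\<in>S. F x) = (\<Prod>x\<in>S. h (F x))" for S :: "nat set" and F
    by (induction S rule: infinite_finite_induct) (simp_all add: coeff_homD[OF assms])
  have pow: "h (a ^ k) = h a ^ k" for a k
    by (induction k) (simp_all add: coeff_homD[OF assms])
  show ?thesis
    by (simp add: hom_eval_def poly_eval_def monom_value_def sum prod pow coeff_homD[OF assms])
qed

lemma hom_eval_diff:
  assumes "coeff_hom h"
  shows "hom_eval h \<alpha> (f - g) = hom_eval h \<alpha> f - hom_eval h \<alpha> g"
  using hom_eval_add[OF assms, of \<alpha> "f - g" g] by (simp add: algebra_simps)

lemmas poly_eval_simps =
  hom_eval_add[OF coeff_hom_id, folded poly_eval_hom_eval]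
  hom_eval_diff[OF coeff_hom_id, folded poly_eval_hom_eval]
  hom_eval_mult[OF coeff_hom_id, folded poly_eval_hom_eval]
  hom_eval_single[OF coeff_hom_id, folded poly_eval_hom_eval]
  hom_eval_1[OF coeff_hom_id, folded poly_eval_hom_eval]
  hom_eval_0[of "\<lambda>c. c", folded poly_eval_hom_eval]

lemma poly_eval_power: "poly_eval (f ^ k) \<alpha> = poly_eval f \<alpha> ^ k"
  by (induction k) (simp_all add: poly_eval_simps)

lemma poly_eval_prod: "poly_eval (\<Prod>x\<in>S. F x) \<alpha> = (\<Prod>x\<in>S. poly_eval (F x) \<alpha>)"
  by (induction S rule: infinite_finite_induct) (simp_all add: poly_eval_simps)

section \<open>Constants, variables, and homogeneous polynomials\<close>

definition const_poly :: "'a::comm_ring_1 \<Rightarrow> 'a mpoly" where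
  "const_poly c = Poly_Mapping.single 0 c"

definition var_poly :: "nat \<Rightarrow> 'a::comm_ring_1 mpoly" where
  "var_poly i = Poly_Mapping.single (Poly_Mapping.single i 1) 1"

lemma coeff_hom_const_poly: "coeff_hom const_poly"
  by (simp add: coeff_hom_def const_poly_def single_add mult_single)

lemma hom_eval_const [simp]: "coeff_hom h \<Longrightarrow> hom_eval h \<alpha> (const_poly c) = h c"
  by (simp add: const_poly_def hom_eval_single)

lemma hom_eval_var [simp]: "coeff_hom h \<Longrightarrow> hom_eval h \<alpha> (var_poly i) = \<alpha> i"
  by (simp add: var_poly_def hom_eval_single coeff_homD)

lemmas poly_eval_const_var [simp] =
  hom_eval_const[OF coeff_hom_id, folded poly_eval_hom_eval]
  hom_eval_var[OF coeff_hom_id, folded poly_eval_hom_eval]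

lemma carrier_poly_ring:
  "p \<in> carrier (poly_ring s) \<longleftrightarrow> (\<forall>m\<in>Poly_Mapping.keys p. Poly_Mapping.keys m \<subseteq> {1..s})"
  by (simp add: poly_ring_def)

lemma poly_ring_simps [simp]:
  "monoid.mult (poly_ring s) = (*)" "one (poly_ring s) = 1"
  "ring.zero (poly_ring s) = 0" "ring.add (poly_ring s) = (+)"
  by (simp_all add: poly_ring_def)

lemma keys_uminus_mpoly: "Poly_Mapping.keys (- f) = Poly_Mapping.keys f"
  by (auto simp: in_keys_iff)

lemma homogeneousD:
  "p \<in> homogeneous_polys s e \<Longrightarrow> p \<in> carrier (poly_ring s)"
  "p \<in> homogeneous_polys s e \<Longrightarrow> m \<in> Poly_Mapping.keys p \<Longrightarrow> monom_degree m = e"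
  by (auto simp: homogeneous_polys_def)

lemma homogeneous_0 [simp, intro]: "0 \<in> homogeneous_polys s e"
  by (simp add: homogeneous_polys_def carrier_poly_ring)

lemma homogeneous_add:
  assumes "p \<in> homogeneous_polys s e" "q \<in> homogeneous_polys s e"
  shows "p + q \<in> homogeneous_polys s e"
  using assms Poly_Mapping.keys_add[of p q] Un_iff subsetD
  unfolding homogeneous_polys_def carrier_poly_ring mem_Collect_eq by metis

lemma homogeneous_uminus:
  "p \<in> homogeneous_polys s e \<Longrightarrow> - p \<in> homogeneous_polys s e"
  by (simp add: homogeneous_polys_def carrier_poly_ring keys_uminus_mpoly)

lemma homogeneous_diff:
  assumes "p \<in> homogeneous_polys s e" "q \<in> homogeneous_polys s e"
  shows "p - q \<in> homogeneous_polys s e"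
  using homogeneous_add[OF assms(1) homogeneous_uminus[OF assms(2)]] by simp

lemma homogeneous_mult:
  assumes "p \<in> homogeneous_polys s a" "q \<in> homogeneous_polys s b"
  shows "p * q \<in> homogeneous_polys s (a + b)"
proof -
  have "Poly_Mapping.keys k \<subseteq> {1..s} \<and> monom_degree k = a + b"
    if k: "k \<in> Poly_Mapping.keys (p * q)" for k
  proof -
    obtain m n where mn: "k = m + n" "m \<in> Poly_Mapping.keys p" "n \<in> Poly_Mapping.keys q"
      using k keys_mult[of p q] by blast
    then show ?thesis
      using assms Poly_Mapping.keys_add[of m n]
      by (fastforce simp: homogeneous_polys_def carrier_poly_ring monom_degree_add)
  qed
  then show ?thesis by (auto simp: homogeneous_polys_def carrier_poly_ring)
qed

lemma homogeneous_const [simp, intro]: "const_poly c \<in> homogeneous_polys s 0"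
  by (simp add: const_poly_def homogeneous_polys_def carrier_poly_ring)

lemma homogeneous_const_mult:
  "p \<in> homogeneous_polys s e \<Longrightarrow> const_poly c * p \<in> homogeneous_polys s e"
  using homogeneous_mult[OF homogeneous_const] by fastforce

lemma homogeneous_var [intro]: "i \<in> {1..s} \<Longrightarrow> var_poly i \<in> homogeneous_polys s 1"
  by (simp add: var_poly_def homogeneous_polys_def carrier_poly_ring)

lemma homogeneous_1 [simp, intro]: "1 \<in> homogeneous_polys s 0"
  by (simp add: homogeneous_polys_def carrier_poly_ring)

lemma homogeneous_prod:
  assumes "\<And>x. x \<in> S \<Longrightarrow> F x \<in> homogeneous_polys s 1"
  shows "(\<Prod>x\<in>S. F x) \<in> homogeneous_polys s (card S)"
  using assms
proof (induction S rule: infinite_finite_induct)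
  case (insert x S)
  then show ?case
    using homogeneous_mult[of "F x" s 1 "\<Prod>x\<in>S. F x" "card S"] by simp
qed simp_all

lemma homogeneous_power:
  "p \<in> homogeneous_polys s 1 \<Longrightarrow> p ^ k \<in> homogeneous_polys s k"
  using homogeneous_prod[of "{..<k}" "\<lambda>_. p" s] by simp

text \<open>On forms, stretching the argument by \<open>c\<close> costs a factor \<open>c\<^sup>e\<close>.  With \<open>c\<close> in the base field this
  makes vanishing independent of the representative; with \<open>c\<close> an indeterminate it describes the
  restriction of a form to a line through the origin.\<close>
lemma hom_eval_scale:
  assumes "f \<in> homogeneous_polys s e"
  shows "hom_eval h (\<lambda>i. c * x i) f = c ^ e * hom_eval h x f"
  using homogeneousD(2)[OF assms]
  by (simp add: hom_eval_def monom_value_scale sum_distrib_left mult_ac)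

lemmas poly_eval_scale = hom_eval_scale[of _ _ _ "\<lambda>c. c", folded poly_eval_hom_eval]

lemma poly_eval_zero:
  assumes "f \<in> homogeneous_polys s e" "e > 0"
  shows "poly_eval f (\<lambda>_. 0) = 0"
  using poly_eval_scale[OF assms(1), of 0] assms(2) by (simp add: power_0_left)

lemma poly_ring_uminus_closed:
  "p \<in> carrier (poly_ring s) \<Longrightarrow> - p \<in> carrier (poly_ring s)"
  by (simp add: carrier_poly_ring keys_uminus_mpoly)

lemma poly_ring_closed:
  fixes p q :: "'a::comm_ring_1 mpoly"
  assumes "p \<in> carrier (poly_ring s)" "q \<in> carrier (poly_ring s)"
  shows "p + q \<in> carrier (poly_ring s)" "p * q \<in> carrier (poly_ring s)"
    "p - q \<in> carrier (poly_ring s)"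
proof -
  have ad: "p + r \<in> carrier (poly_ring s)" if "r \<in> carrier (poly_ring s)" for r
    using assms(1) that Poly_Mapping.keys_add[of p r] Un_iff subsetD
    unfolding carrier_poly_ring by metis
  show "p + q \<in> carrier (poly_ring s)" "p - q \<in> carrier (poly_ring s)"
    using ad[OF assms(2)] ad[OF poly_ring_uminus_closed[OF assms(2)]] by simp_all
  show "p * q \<in> carrier (poly_ring s)"
    unfolding carrier_poly_ring
  proof
    fix k assume "k \<in> Poly_Mapping.keys (p * q)"
    then obtain m n where mn: "k = m + n" "m \<in> Poly_Mapping.keys p" "n \<in> Poly_Mapping.keys q"
      using keys_mult[of p q] by blast
    then show "Poly_Mapping.keys k \<subseteq> {1..s}"
      using assms Poly_Mapping.keys_add[of m n] by (fastforce simp: carrier_poly_ring)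
  qed
qed

lemma const_poly_carrier [simp, intro]: "const_poly c \<in> carrier (poly_ring s)"
  using homogeneousD(1) by blast

lemma var_poly_carrier [intro]: "i \<in> {1..s} \<Longrightarrow> var_poly i \<in> carrier (poly_ring s)"
  using homogeneousD(1) by blast

lemma zero_one_carrier [simp, intro]:
  "0 \<in> carrier (poly_ring s)" "1 \<in> carrier (poly_ring s)"
  using homogeneousD(1) homogeneous_0 homogeneous_1 by blast+

lemma poly_ring_cring: "cring (poly_ring s :: 'a::comm_ring_1 mpoly ring)"
proof (rule cringI)
  have inv: "\<exists>y\<in>carrier (poly_ring s). x + y = 0"
    if "x \<in> carrier (poly_ring s)" for x :: "'a mpoly"
    using poly_ring_uminus_closed[OF that] by (intro bexI[of _ "- x"]) simp_all
  show "abelian_group (poly_ring s :: 'a mpoly ring)"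
    by (rule abelian_groupI) (simp_all add: poly_ring_closed add_ac inv)
  show "comm_monoid (poly_ring s :: 'a mpoly ring)"
    by (rule comm_monoidI) (simp_all add: poly_ring_closed mult_ac)
qed (simp add: distrib_right)

lemma poly_ring_minus:
  fixes p q :: "'a::comm_ring_1 mpoly"
  assumes "p \<in> carrier (poly_ring s)" "q \<in> carrier (poly_ring s)"
  shows "p \<ominus>\<^bsub>poly_ring s\<^esub> q = p - q"
proof -
  interpret cring "poly_ring s :: 'a mpoly ring" by (rule poly_ring_cring)
  have "\<ominus>\<^bsub>poly_ring s\<^esub> q = - q"
    using assms(2) poly_ring_uminus_closed[OF assms(2)] by (intro minus_equality) simp_all
  then show ?thesis by (simp add: a_minus_def)
qed

lemma poly_ring_induct [consumes 1, case_names const var add mult]: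
  assumes f: "f \<in> carrier (poly_ring s)"
    and const: "\<And>c. P (const_poly c)"
    and var: "\<And>i. i \<in> {1..s} \<Longrightarrow> P (var_poly i)"
    and add: "\<And>p q. p \<in> carrier (poly_ring s) \<Longrightarrow> q \<in> carrier (poly_ring s) \<Longrightarrow>
      P p \<Longrightarrow> P q \<Longrightarrow> P (p + q)"
    and mult: "\<And>p q. p \<in> carrier (poly_ring s) \<Longrightarrow> q \<in> carrier (poly_ring s) \<Longrightarrow>
      P p \<Longrightarrow> P q \<Longrightarrow> P (p * q)"
  shows "P f"
proof -
  define Q where "Q p \<longleftrightarrow> p \<in> carrier (poly_ring s) \<and> P p" for p
  have Q0: "Q 0" and Q1: "Q 1"
    using const[of 0] const[of 1] by (simp_all add: Q_def const_poly_def)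
  have Qvar: "Q (var_poly i)" if "i \<in> {1..s}" for i
    using var[OF that] that by (auto simp: Q_def)
  have Qc: "Q (const_poly c)" for c using const by (simp add: Q_def)
  have Qadd: "Q (p + q)" and Qmult: "Q (p * q)" if "Q p" "Q q" for p q
    using that add mult poly_ring_closed by (auto simp: Q_def)
  have Qsum: "Q (\<Sum>x\<in>S. F x)" if "\<And>x. x \<in> S \<Longrightarrow> Q (F x)" for S :: "(nat \<Rightarrow>\<^sub>0 nat) set" and F
    using that by (induction S rule: infinite_finite_induct) (auto simp: Q0 Qadd)
  have Qprod: "Q (\<Prod>x\<in>S. F x)" if "\<And>x. x \<in> S \<Longrightarrow> Q (F x)" for S :: "nat set" and F
    using that by (induction S rule: infinite_finite_induct) (auto simp: Q1 Qmult)
  have Qpow: "Q (p ^ k)" if "Q p" for p k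
    using that by (induction k) (auto simp: Q1 Qmult)
  have mono: "Poly_Mapping.single m c = const_poly c * monom_value var_poly m"
    for m :: "nat \<Rightarrow>\<^sub>0 nat" and c :: 'a
  proof -
    have pw: "(var_poly i :: 'a mpoly) ^ k = Poly_Mapping.single (Poly_Mapping.single i k) 1" for i k
      by (induction k) (simp_all add: var_poly_def mult_single flip: single_add)
    have pr: "(\<Prod>i\<in>S. Poly_Mapping.single (M i) (1::'a)) = Poly_Mapping.single (\<Sum>i\<in>S. M i) 1"
      for S :: "nat set" and M :: "nat \<Rightarrow> nat \<Rightarrow>\<^sub>0 nat"
      by (induction S rule: infinite_finite_induct) (simp_all add: mult_single)
    have "(\<Sum>i\<in>Poly_Mapping.keys m. Poly_Mapping.single i (Poly_Mapping.lookup m i)) = m"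
      by (rule poly_mapping_eqI) (simp add: lookup_sum lookup_single when_def in_keys_iff)
    then show ?thesis
      by (simp add: monom_value_def pw pr const_poly_def mult_single)
  qed
  have "Q (Poly_Mapping.single m (Poly_Mapping.lookup f m))" if "m \<in> Poly_Mapping.keys f" for m
  proof -
    have "Poly_Mapping.keys m \<subseteq> {1..s}" using f that by (simp add: carrier_poly_ring)
    then have "Q (monom_value var_poly m)"
      unfolding monom_value_def by (intro Qprod Qpow Qvar) blast
    then show ?thesis unfolding mono by (rule Qmult[OF Qc])
  qed
  then have "Q f" by (subst mpoly_sum_monomials) (rule Qsum)
  then show ?thesis by (simp add: Q_def)
qed

section \<open>A Nullstellensatz for punctured grids\<close>

text \<open>The barycentric weight of the node \<open>a\<close> in Lagrange interpolation on \<open>B\<close>.\<close>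
definition node_weight :: "'a::field set \<Rightarrow> 'a \<Rightarrow> 'a" where
  "node_weight B a = inverse (\<Prod>b\<in>B - {a}. a - b)"

lemma node_weight_nonzero: "finite B \<Longrightarrow> node_weight B a \<noteq> 0"
  by (simp add: node_weight_def)

text \<open>Interpolation at the nodes \<open>B\<close> reproduces \<open>Y\<^sup>k\<close>, and the sum is the coefficient of
  \<open>Y\<^bsup>card B - 1\<^esup>\<close> in the interpolation polynomial.\<close>
lemma sum_node_weight_power:
  fixes B :: "'a::field set"
  assumes fin: "finite B" and k: "k < card B - 1"
  shows "(\<Sum>a\<in>B. node_weight B a * a ^ k) = 0"
proof -
  define n where "n = card B - 1"
  define q where "q a = (\<Prod>b\<in>B - {a}. [:- b, 1:])" for a
  have deg_q: "degree (q a) = n" if "a \<in> B" for a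
  proof -
    have "degree (q a) = (\<Sum>b\<in>B - {a}. degree [:- b, 1:])"
      unfolding q_def by (rule degree_prod_eq_sum_degree) simp
    then show ?thesis using fin that by (simp add: n_def)
  qed
  have lead_q: "coeff (q a) n = 1" if "a \<in> B" for a
  proof -
    have "lead_coeff (q a) = 1" unfolding q_def by (simp add: lead_coeff_prod)
    then show ?thesis using deg_q[OF that] by simp
  qed
  \<comment> \<open>The interpolation polynomial of \<open>Y\<^sup>k\<close> minus \<open>Y\<^sup>k\<close>: too many roots for its degree.\<close>
  define p where "p = (\<Sum>a\<in>B. smult (node_weight B a * a ^ k) (q a)) - monom 1 k"
  have root: "poly p c = 0" if c: "c \<in> B" for c
  proof -
    have "poly (q a) c = (if a = c then (\<Prod>b\<in>B - {c}. c - b) else 0)" if "a \<in> B" for a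
    proof (cases "a = c")
      case False
      then have "c \<in> B - {a}" using c by simp
      then have "(\<Prod>b\<in>B - {a}. c - b) = 0" using fin by (intro prod_zero) auto
      then show ?thesis using False by (simp add: q_def poly_prod)
    qed (simp add: q_def poly_prod)
    then have "(\<Sum>a\<in>B. node_weight B a * a ^ k * poly (q a) c) =
        (\<Sum>a\<in>B. if a = c then node_weight B a * a ^ k * (\<Prod>b\<in>B - {c}. c - b) else 0)"
      by (intro sum.cong) auto
    then have "poly p c =
        (\<Sum>a\<in>B. if a = c then node_weight B a * a ^ k * (\<Prod>b\<in>B - {c}. c - b) else 0) - c ^ k"
      by (simp add: p_def poly_sum poly_monom)
    also have "\<dots> = 0"
      using fin c by (simp add: sum.delta node_weight_def)
    finally show ?thesis .
  qed
  have "degree p \<le> n"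
    unfolding p_def using k deg_q
    by (intro degree_diff_le degree_sum_le)
      (auto simp: degree_monom_eq fin n_def intro: order_trans[OF degree_smult_le])
  moreover have "card {x. poly p x = 0} > n" if "p \<noteq> 0"
  proof -
    have "card B \<le> card {x. poly p x = 0}"
      using root poly_roots_finite[OF that] by (intro card_mono) auto
    then show ?thesis using k by (simp add: n_def)
  qed
  ultimately have "p = 0"
    using card_poly_roots_bound[of p] by fastforce
  then have "0 = coeff p n" by simp
  also have "\<dots> = (\<Sum>a\<in>B. node_weight B a * a ^ k)"
    using k[folded n_def] lead_q by (simp add: p_def coeff_sum)
  finally show ?thesis by simp
qed

definition grid :: "nat \<Rightarrow> (nat \<Rightarrow> 'a::zero set) \<Rightarrow> (nat \<Rightarrow> 'a) set" where
  "grid s B = {x \<in> affine_space s. \<forall>i\<in>{1..s}. x i \<in> B i}"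

text \<open>The sum over the grid factors for each monomial.  A monomial of low degree has some exponent
  below the size of the corresponding side minus one, and this factor is zero.\<close>
lemma sum_grid_weight_eq_0:
  fixes B :: "nat \<Rightarrow> 'a::field set"
  assumes fin: "\<And>i. i \<in> {1..s} \<Longrightarrow> finite (B i)"
    and f: "f \<in> carrier (poly_ring s)"
    and deg: "\<And>m. m \<in> Poly_Mapping.keys f \<Longrightarrow> monom_degree m < (\<Sum>i=1..s. card (B i) - 1)"
  shows "(\<Sum>x\<in>PiE {1..s} B. (\<Prod>i=1..s. node_weight (B i) (x i)) * poly_eval f x) = 0"
proof -
  have mono: "(\<Sum>x\<in>PiE {1..s} B. (\<Prod>i=1..s. node_weight (B i) (x i)) * monom_value x m) = 0"
    if m: "m \<in> Poly_Mapping.keys f" for m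
  proof -
    let ?e = "Poly_Mapping.lookup m"
    have keys: "Poly_Mapping.keys m \<subseteq> {1..s}" using f m by (simp add: carrier_poly_ring)
    have "(\<Sum>i=1..s. ?e i) = monom_degree m"
      unfolding monom_degree_def using keys
      by (intro sum.mono_neutral_right) (auto simp: in_keys_iff)
    then have "\<exists>i\<in>{1..s}. ?e i < card (B i) - 1"
      using deg[OF m] by (metis (no_types, lifting) not_le sum_mono)
    then obtain i where i: "i \<in> {1..s}" "?e i < card (B i) - 1" by blast
    have "(\<Sum>x\<in>PiE {1..s} B. (\<Prod>i=1..s. node_weight (B i) (x i)) * monom_value x m)
        = (\<Sum>x\<in>PiE {1..s} B. \<Prod>i=1..s. node_weight (B i) (x i) * x i ^ ?e i)"
      using keys by (simp add: monom_value_superset[of "{1..s}"] prod.distrib)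
    also have "\<dots> = (\<Prod>i=1..s. \<Sum>a\<in>B i. node_weight (B i) a * a ^ ?e i)"
      using fin by (subst prod_sum_PiE) auto
    also have "\<dots> = 0"
      using i fin by (intro prod_zero) (auto intro!: bexI[of _ i] sum_node_weight_power)
    finally show ?thesis .
  qed
  have "(\<Sum>x\<in>PiE {1..s} B. (\<Prod>i=1..s. node_weight (B i) (x i)) * poly_eval f x)
      = (\<Sum>m\<in>Poly_Mapping.keys f. Poly_Mapping.lookup f m *
          (\<Sum>x\<in>PiE {1..s} B. (\<Prod>i=1..s. node_weight (B i) (x i)) * monom_value x m))"
    by (simp add: poly_eval_hom_eval hom_eval_def sum_distrib_left sum_distrib_right mult_ac)
      (rule sum.swap)
  also have "\<dots> = 0" by (intro sum.neutral ballI) (simp only: mono mult_zero_right)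
  finally show ?thesis .
qed

lemma poly_eval_cong:
  assumes "f \<in> carrier (poly_ring s)" "\<And>i. i \<in> {1..s} \<Longrightarrow> x i = y i"
  shows "poly_eval f x = poly_eval f y"
  unfolding poly_eval_def using assms
  by (intro sum.cong prod.cong arg_cong2[where f = "(*)"] refl) (force simp: carrier_poly_ring)

text \<open>All the weights are non-zero.  So if all terms of the weighted sum but one are zero and the
  sum is zero, the last term is zero as well.\<close>
theorem punctured_grid:
  fixes B :: "nat \<Rightarrow> 'a::field set"
  assumes fin: "\<And>i. i \<in> {1..s} \<Longrightarrow> finite (B i)"
    and f: "f \<in> homogeneous_polys s e"
    and deg: "e < (\<Sum>i=1..s. card (B i) - 1)"
    and x: "x \<in> grid s B"
    and vanish: "\<And>y. y \<in> grid s B \<Longrightarrow> y \<noteq> x \<Longrightarrow> poly_eval f y = 0"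
  shows "poly_eval f x = 0"
proof -
  \<comment> \<open>Points of \<open>affine_space\<close> are 0 off the index set, elements of \<open>PiE\<close> are \<open>undefined\<close> there.\<close>
  let ?r = "\<lambda>y. restrict y {1..s}"
  let ?w = "\<lambda>y. (\<Prod>i=1..s. node_weight (B i) (y i))"
  have eval_r: "poly_eval f (?r y) = poly_eval f y" for y
    using homogeneousD(1)[OF f] by (rule poly_eval_cong) simp
  have rx: "?r x \<in> PiE {1..s} B" using x by (auto simp: grid_def)
  have other: "poly_eval f z = 0" if z: "z \<in> PiE {1..s} B" "z \<noteq> ?r x" for z
  proof -
    define y where "y i = (if i \<in> {1..s} then z i else 0)" for i
    have ry: "?r y = z" using z(1) by (auto simp: y_def restrict_def PiE_def extensional_def)
    have "y \<in> grid s B" using z(1) by (auto simp: grid_def affine_space_def y_def PiE_def)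
    moreover have "y \<noteq> x" using z(2) ry by auto
    ultimately show ?thesis using vanish eval_r[of y] ry by simp
  qed
  have "0 = (\<Sum>z\<in>PiE {1..s} B. ?w z * poly_eval f z)"
    using homogeneousD(2)[OF f] deg
      sum_grid_weight_eq_0[of s B f] fin homogeneousD(1)[OF f] by simp
  also have "\<dots> = (\<Sum>z\<in>{?r x}. ?w z * poly_eval f z)"
    using rx other fin by (intro sum.mono_neutral_right) (auto intro: finite_PiE)
  also have "\<dots> = ?w (?r x) * poly_eval f x" by (simp add: eval_r del: One_nat_def)
  finally show ?thesis using fin by (auto simp: node_weight_nonzero)
qed

section \<open>Projective points and forms separating them\<close>

abbreviation nonzero_vectors :: "nat \<Rightarrow> (nat \<Rightarrow> 'a::zero) set" where
  "nonzero_vectors s \<equiv> affine_space s - {\<lambda>_. 0}"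

lemma mem_proj_point:
  assumes "x \<in> nonzero_vectors s"
  shows "y \<in> proj_point s x \<longleftrightarrow> (\<exists>c. c \<noteq> 0 \<and> y = (\<lambda>i. c * x i))"
proof
  assume "\<exists>c. c \<noteq> 0 \<and> y = (\<lambda>i. c * x i)"
  then obtain c where c: "c \<noteq> 0" "y = (\<lambda>i. c * x i)" by blast
  moreover have "y \<in> nonzero_vectors s"
    using assms c by (auto simp: affine_space_def fun_eq_iff)
  ultimately show "y \<in> proj_point s x"
    using assms unfolding proj_point_def proportional_def by blast
qed (auto simp: proj_point_def proportional_def)

lemma proj_point_self: "x \<in> nonzero_vectors s \<Longrightarrow> x \<in> proj_point s x"
  by (subst mem_proj_point) (auto intro!: exI[of _ 1])

lemma proj_point_eqI:
  assumes x: "x \<in> nonzero_vectors s" and y: "y \<in> proj_point s x"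
  shows "y \<in> nonzero_vectors s" "proj_point s y = proj_point s x"
proof -
  obtain c where c: "c \<noteq> 0" "y = (\<lambda>i. c * x i)" using x y by (auto simp: mem_proj_point)
  show ny: "y \<in> nonzero_vectors s" using y by (auto simp: proj_point_def proportional_def)
  show "proj_point s y = proj_point s x"
  proof (rule Set.set_eqI)
    fix z
    have "(\<exists>k. k \<noteq> 0 \<and> z = (\<lambda>i. k * y i)) \<longleftrightarrow> (\<exists>k. k \<noteq> 0 \<and> z = (\<lambda>i. k * x i))"
    proof
      assume "\<exists>k. k \<noteq> 0 \<and> z = (\<lambda>i. k * y i)"
      then obtain k where "k \<noteq> 0" "z = (\<lambda>i. k * y i)" by blast
      then show "\<exists>k. k \<noteq> 0 \<and> z = (\<lambda>i. k * x i)"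
        using c by (intro exI[of _ "k * c"]) (auto simp: mult_ac)
    next
      assume "\<exists>k. k \<noteq> 0 \<and> z = (\<lambda>i. k * x i)"
      then obtain k where "k \<noteq> 0" "z = (\<lambda>i. k * x i)" by blast
      then show "\<exists>k. k \<noteq> 0 \<and> z = (\<lambda>i. k * y i)"
        using c by (intro exI[of _ "k / c"]) (auto simp: field_simps)
    qed
    then show "z \<in> proj_point s y \<longleftrightarrow> z \<in> proj_point s x"
      by (simp only: mem_proj_point[OF x] mem_proj_point[OF ny])
  qed
qed

lemma projective_space_eq: "projective_space s = proj_point s ` nonzero_vectors s"
  by (auto simp: projective_space_def proj_point_def quotient_def)

text \<open>Dividing a representative by its first non-zero entry is the only way to normalise it.\<close>
lemma standard_rep:
  assumes "P \<in> projective_space s"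
  shows "standard_rep P \<in> P" "standard_rep P \<in> nonzero_vectors s"
    "proj_point s (standard_rep P) = P"
proof -
  obtain x where x: "x \<in> nonzero_vectors s" "P = proj_point s x"
    using assms by (auto simp: projective_space_eq)
  define i where "i = (LEAST i. x i \<noteq> 0)"
  have ex: "\<exists>i. x i \<noteq> 0" using x(1) by (auto simp: fun_eq_iff)
  have xi: "x i \<noteq> 0" unfolding i_def by (rule LeastI_ex[OF ex])
  have below: "x j = 0" if "j < i" for j using that not_less_Least unfolding i_def by blast
  let ?y = "\<lambda>j. inverse (x i) * x j"
  let ?N = "\<lambda>\<alpha>. \<alpha> \<in> P \<and> (\<exists>i. \<alpha> i = 1 \<and> (\<forall>j<i. \<alpha> j = 0))"
  have "?N ?y"
    using x xi below by (auto simp: mem_proj_point intro!: exI[of _ "inverse (x i)"] exI[of _ i])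
  moreover have "\<alpha> = ?y" if \<alpha>: "?N \<alpha>" for \<alpha>
  proof -
    obtain c k where c: "c \<noteq> 0" "\<alpha> = (\<lambda>j. c * x j)" "\<alpha> k = 1" "\<forall>j<k. \<alpha> j = 0"
      using \<alpha> x by (auto simp: mem_proj_point)
    have "k = i"
    proof (rule linorder_cases[of k i])
      assume "k < i" then show ?thesis using c below[of k] by simp
    next
      assume "i < k" then show ?thesis using c xi by auto
    qed
    then have "c * x i = 1" using c by simp
    then have "c = inverse (x i)" using xi by (simp add: field_simps)
    then show ?thesis using c by simp
  qed
  ultimately have "?N (standard_rep P)"
    unfolding standard_rep_def by (rule theI2)
  then show r: "standard_rep P \<in> P" by simp
  show "standard_rep P \<in> nonzero_vectors s" "proj_point s (standard_rep P) = P"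
    using proj_point_eqI[OF x(1)] r x(2) by blast+
qed

lemma vanishes_on_point_iff:
  assumes x: "x \<in> nonzero_vectors s" and f: "f \<in> homogeneous_polys s e"
  shows "(\<forall>\<alpha>\<in>proj_point s x. poly_eval f \<alpha> = 0) \<longleftrightarrow> poly_eval f x = 0"
proof
  assume "poly_eval f x = 0"
  then show "\<forall>\<alpha>\<in>proj_point s x. poly_eval f \<alpha> = 0"
    by (auto simp: mem_proj_point[OF x] poly_eval_scale[OF f])
qed (use proj_point_self[OF x] in blast)

lemma zero_set_rep:
  assumes "X \<subseteq> projective_space s" "f \<in> homogeneous_polys s e"
  shows "zero_set X f = {P \<in> X. poly_eval f (standard_rep P) = 0}"
proof -
  have "(\<forall>\<alpha>\<in>P. poly_eval f \<alpha> = 0) \<longleftrightarrow> poly_eval f (standard_rep P) = 0" if "P \<in> X" for P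
    using vanishes_on_point_iff[OF standard_rep(2) assms(2)] standard_rep(3) that assms(1)
    by (metis subsetD)
  then show ?thesis by (auto simp: zero_set_def)
qed

lemma nonzero_coordinate:
  assumes "x \<in> nonzero_vectors s"
  obtains i where "i \<in> {1..s}" "x i \<noteq> 0"
  using assms that by (auto simp: affine_space_def fun_eq_iff)

text \<open>The \<open>2 \<times> 2\<close> minors of the matrix with rows \<open>y\<close> and \<open>(t\<^sub>1, \<dots>, t\<^sub>s)\<close> vanish at \<open>y\<close>, and their
  common zeros are the multiples of \<open>y\<close>.\<close>
lemma separating_linear_form:
  fixes P Q :: "(nat \<Rightarrow> 'a::field) set"
  assumes P: "P \<in> projective_space s" and Q: "Q \<in> projective_space s" and "P \<noteq> Q"
  obtains L where "L \<in> homogeneous_polys s 1"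
    "poly_eval L (standard_rep P) \<noteq> 0" "poly_eval L (standard_rep Q) = 0"
proof -
  let ?x = "standard_rep P" and ?y = "standard_rep Q"
  note x = standard_rep[OF P] and y = standard_rep[OF Q]
  obtain b where b: "b \<in> {1..s}" "?y b \<noteq> 0" using nonzero_coordinate[OF y(2)] .
  define L where "L a = const_poly (?y b) * var_poly a - const_poly (?y a) * var_poly b" for a
  have L: "L a \<in> homogeneous_polys s 1" if "a \<in> {1..s}" for a
    unfolding L_def using that b by (intro homogeneous_diff homogeneous_const_mult homogeneous_var)
  have eval_L: "poly_eval (L a) z = ?y b * z a - ?y a * z b" for a z
    by (simp add: L_def poly_eval_simps)
  have "\<exists>a\<in>{1..s}. poly_eval (L a) ?x \<noteq> 0"
  proof (rule ccontr)
    assume "\<not> ?thesis"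
    then have eq: "?y b * ?x a = ?y a * ?x b" if "a \<in> {1..s}" for a
      using that by (auto simp: eval_L)
    have multiple: "?x a = (?x b / ?y b) * ?y a" for a
    proof (cases "a \<in> {1..s}")
      case True
      then show ?thesis using eq[OF True] b(2) by (simp add: field_simps)
    next
      case False
      then show ?thesis using x(2) y(2) unfolding affine_space_def by auto
    qed
    define c where "c = ?x b / ?y b"
    have xc: "?x = (\<lambda>a. c * ?y a)" unfolding c_def by (rule ext) (rule multiple)
    then have "c \<noteq> 0" using x(2) by auto
    then have "?x \<in> proj_point s ?y" using xc mem_proj_point[OF y(2)] by blast
    then have "P = Q" using proj_point_eqI(2)[OF y(2)] x(3) y(3) by simp
    then show False using \<open>P \<noteq> Q\<close> by contradiction
  qed
  then obtain a where "a \<in> {1..s}" "poly_eval (L a) ?x \<noteq> 0" by blast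
  then show ?thesis using that[OF L] by (simp add: eval_L)
qed

text \<open>The product of the linear forms that separate \<open>P\<close> from the single points of \<open>Y\<close>.\<close>
lemma separator:
  fixes P :: "(nat \<Rightarrow> 'a::field) set"
  assumes P: "P \<in> projective_space s" and "finite Y" "Y \<subseteq> projective_space s" "P \<notin> Y"
  shows "\<exists>F\<in>homogeneous_polys s (card Y). poly_eval F (standard_rep P) \<noteq> 0 \<and>
    (\<forall>Q\<in>Y. poly_eval F (standard_rep Q) = 0)"
proof -
  have "\<forall>Q\<in>Y. \<exists>L. L \<in> homogeneous_polys s 1 \<and>
      poly_eval L (standard_rep P) \<noteq> 0 \<and> poly_eval L (standard_rep Q) = 0"
    using assms by (metis separating_linear_form subsetD)
  then obtain L where L: "\<And>Q. Q \<in> Y \<Longrightarrow> L Q \<in> homogeneous_polys s 1 \<and>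
      poly_eval (L Q) (standard_rep P) \<noteq> 0 \<and> poly_eval (L Q) (standard_rep Q) = 0"
    by metis
  have "(\<Prod>Q\<in>Y. L Q) \<in> homogeneous_polys s (card Y)" using L by (intro homogeneous_prod) blast
  moreover have "poly_eval (\<Prod>Q\<in>Y. L Q) (standard_rep P) \<noteq> 0"
    using L \<open>finite Y\<close> by (simp add: poly_eval_prod)
  moreover have "poly_eval (\<Prod>Q\<in>Y. L Q) (standard_rep Q) = 0" if "Q \<in> Y" for Q
    using L[OF that] \<open>finite Y\<close> that by (auto simp: poly_eval_prod)
  ultimately show ?thesis by blast
qed

text \<open>A coordinate that is non-zero at \<open>P\<close> pads the degree of a separator.\<close>
lemma separator_of_large_degree:
  fixes P :: "(nat \<Rightarrow> 'a::field) set"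
  assumes P: "P \<in> projective_space s" and Y: "finite Y" "Y \<subseteq> projective_space s" "P \<notin> Y"
    and e: "card Y \<le> e"
  shows "\<exists>F\<in>homogeneous_polys s e. poly_eval F (standard_rep P) \<noteq> 0 \<and>
    (\<forall>Q\<in>Y. poly_eval F (standard_rep Q) = 0)"
proof -
  obtain F where F: "F \<in> homogeneous_polys s (card Y)" "poly_eval F (standard_rep P) \<noteq> 0"
      "\<forall>Q\<in>Y. poly_eval F (standard_rep Q) = 0"
    using separator[OF P Y] by blast
  obtain i where i: "i \<in> {1..s}" "standard_rep P i \<noteq> 0"
    using nonzero_coordinate[OF standard_rep(2)[OF P]] .
  let ?G = "var_poly i ^ (e - card Y) * F"
  have "?G \<in> homogeneous_polys s e"
    using homogeneous_mult[OF homogeneous_power[OF homogeneous_var[OF i(1)], of "e - card Y"] F(1)]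
      e by simp
  moreover have "poly_eval ?G (standard_rep P) \<noteq> 0" "\<forall>Q\<in>Y. poly_eval ?G (standard_rep Q) = 0"
    using F i by (simp_all add: poly_eval_simps poly_eval_power)
  ultimately show ?thesis by blast
qed

section \<open>Counting the points where a form does not vanish\<close>

lemma finite_affine_space: "finite (affine_space s :: (nat \<Rightarrow> 'a::{zero, finite}) set)"
proof -
  have "affine_space s = {f :: nat \<Rightarrow> 'a. \<forall>x. (x \<in> {1..s} \<longrightarrow> f x \<in> UNIV) \<and> (x \<notin> {1..s} \<longrightarrow> f x = 0)}"
    by (auto simp: affine_space_def)
  then show ?thesis using finite_set_of_finite_funs[of "{1..s}" "UNIV :: 'a set"] by simp
qed

lemma finite_projective_space: "finite (projective_space s :: (nat \<Rightarrow> 'a::{field, finite}) set set)"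
  unfolding projective_space_eq using finite_affine_space by blast

text \<open>Multiplying \<open>f\<close> by a separator of \<open>P\<close> from the other points where \<open>f\<close> does not vanish
  gives a form that is non-zero at \<open>P\<close> alone.  Shrinking one side of the grid to \<open>{0, x i}\<close> leaves a
  single representative \<open>x\<close> of \<open>P\<close>, so the form cannot have low degree.\<close>
theorem card_nonzeros_lower_bound:
  fixes A :: "nat \<Rightarrow> 'a::{field, finite} set"
  assumes zero: "\<And>i. i \<in> {1..s} \<Longrightarrow> 0 \<in> A i"
    and X: "X = projective_cartesian_set s A"
    and f: "f \<in> homogeneous_polys s d" and d: "d > 0" and nv: "zero_set X f \<noteq> X"
  shows "\<exists>i\<in>{1..s}. (\<Sum>j\<in>{1..s} - {i}. card (A j) - 1) + 2 \<le> d + card (X - zero_set X f)"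
proof -
  have X_sub: "X \<subseteq> projective_space s" using X projective_cartesian_set_subset by blast
  have X_eq: "X = proj_point s ` (grid s A - {\<lambda>_. 0})"
    by (simp add: X projective_cartesian_set_def grid_def)
  define Y where "Y = X - zero_set X f"
  have finY: "finite Y"
    using finite_projective_space X_sub by (auto simp: Y_def intro: finite_subset)
  have Y_sub: "Y \<subseteq> projective_space s" using X_sub by (auto simp: Y_def)
  obtain P where P: "P \<in> Y" using nv by (auto simp: Y_def zero_set_def)
  then obtain x where x: "x \<in> grid s A" "x \<noteq> (\<lambda>_. 0)" "P = proj_point s x"
    by (auto simp: Y_def X_eq)
  have nx: "x \<in> nonzero_vectors s" using x by (simp add: grid_def)
  obtain i where i: "i \<in> {1..s}" "x i \<noteq> 0" using nonzero_coordinate[OF nx] .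
  obtain F where F: "F \<in> homogeneous_polys s (card (Y - {P}))"
      "poly_eval F (standard_rep P) \<noteq> 0" "\<forall>Q\<in>Y - {P}. poly_eval F (standard_rep Q) = 0"
    using separator[of P s "Y - {P}"] P finY Y_sub by blast
  define g where "g = f * F"
  have g: "g \<in> homogeneous_polys s (d + (card Y - 1))"
    unfolding g_def using homogeneous_mult[OF f F(1)] P finY by simp
  have g_rep: "poly_eval g y = 0 \<longleftrightarrow> poly_eval g (standard_rep Q) = 0"
    if "y \<in> nonzero_vectors s" "Q = proj_point s y" for y Q
  proof -
    have "Q \<in> projective_space s" using that by (auto simp: projective_space_eq)
    then show ?thesis
      using vanishes_on_point_iff[OF that(1) g]
        vanishes_on_point_iff[OF standard_rep(2) g, of Q] standard_rep(3)[of Q] that(2) by simp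
  qed
  have "poly_eval f (standard_rep P) \<noteq> 0"
    using P zero_set_rep[OF X_sub f] by (auto simp: Y_def)
  then have gx: "poly_eval g x \<noteq> 0"
    using g_rep[OF nx x(3)] F(2) by (simp add: g_def poly_eval_simps)
  have g_other: "poly_eval g (standard_rep Q) = 0" if Q: "Q \<in> X" "Q \<noteq> P" for Q
  proof (cases "Q \<in> Y")
    case True
    then show ?thesis using F(3) Q by (simp add: g_def poly_eval_simps)
  next
    case False
    then show ?thesis
      using Q zero_set_rep[OF X_sub f] by (auto simp: Y_def g_def poly_eval_simps)
  qed
  define B where "B = A(i := {0, x i})"
  have xB: "x \<in> grid s B" using x(1) by (auto simp: grid_def B_def)
  have "d + (card Y - 1) \<ge> (\<Sum>j=1..s. card (B j) - 1)"
  proof (rule ccontr)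
    assume "\<not> ?thesis"
    then have low: "d + (card Y - 1) < (\<Sum>j=1..s. card (B j) - 1)" by simp
    have "poly_eval g y = 0" if y: "y \<in> grid s B" "y \<noteq> x" for y
    proof (cases "y = (\<lambda>_. 0)")
      case True
      then show ?thesis using poly_eval_zero[OF g] d by simp
    next
      case False
      have yA: "y \<in> grid s A"
        using y(1) x(1) zero i unfolding grid_def B_def by (auto split: if_splits)
      then have ny: "y \<in> nonzero_vectors s" using False by (simp add: grid_def)
      have "proj_point s y \<noteq> P"
      proof
        assume "proj_point s y = P"
        then have "y \<in> proj_point s x" using proj_point_self[OF ny] x(3) by simp
        then obtain c where c: "c \<noteq> 0" "y = (\<lambda>j. c * x j)" by (auto simp: mem_proj_point[OF nx])
        \<comment> \<open>The shrunken side fixes the scaling factor.\<close>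
        have "y i = 0 \<or> y i = x i"
          using y(1) i(1) unfolding grid_def B_def
          by (metis (mono_tags, lifting) fun_upd_same insertE mem_Collect_eq singletonD)
        then have "c = 1" using c i(2) by auto
        then show False using c y(2) by simp
      qed
      then have "poly_eval g (standard_rep (proj_point s y)) = 0"
        using g_other[of "proj_point s y"] yA False by (auto simp: X_eq)
      then show ?thesis using g_rep[OF ny refl] by simp
    qed
    then have "poly_eval g x = 0" using punctured_grid[OF _ g low xB] by simp
    then show False using gx by contradiction
  qed
  moreover have "(\<Sum>j=1..s. card (B j) - 1) = (\<Sum>j\<in>{1..s} - {i}. card (A j) - 1) + 1"
    using i by (subst sum.remove[of "{1..s}" i]) (auto simp: B_def intro: sum.cong)
  moreover have "card Y \<ge> 1" using P finY card_gt_0_iff[of Y] by (auto simp: Suc_le_eq)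
  ultimately show ?thesis using i(1) unfolding Y_def by (intro bexI[of _ i]) simp_all
qed

section \<open>The vanishing ideal\<close>

lemma poly_ring_idealI:
  fixes J :: "'a::comm_ring_1 mpoly set"
  assumes "J \<subseteq> carrier (poly_ring s)" "0 \<in> J"
    and "\<And>p q. p \<in> J \<Longrightarrow> q \<in> J \<Longrightarrow> p + q \<in> J" "\<And>p. p \<in> J \<Longrightarrow> - p \<in> J"
    and "\<And>p r. p \<in> J \<Longrightarrow> r \<in> carrier (poly_ring s) \<Longrightarrow> r * p \<in> J"
  shows "ideal J (poly_ring s)"
proof -
  interpret cring "poly_ring s :: 'a mpoly ring" by (rule poly_ring_cring)
  have inv: "\<ominus>\<^bsub>poly_ring s\<^esub> p = - p" if "p \<in> carrier (poly_ring s)" for p :: "'a mpoly"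
    using that poly_ring_uminus_closed[OF that] by (intro minus_equality) simp_all
  show ?thesis
  proof (rule idealI)
    show "ring (poly_ring s :: 'a mpoly ring)" by (rule ring_axioms)
    show "subgroup J (add_monoid (poly_ring s))"
    proof (rule subgroup.intro)
      show "inv\<^bsub>add_monoid (poly_ring s)\<^esub> p \<in> J" if "p \<in> J" for p
      proof -
        have "inv\<^bsub>add_monoid (poly_ring s)\<^esub> p = - p"
          using inv[of p] that assms(1) by (auto simp: a_inv_def)
        then show ?thesis using assms(4)[OF that] by simp
      qed
    qed (use assms in auto)
  qed (use assms in \<open>simp_all add: mult.commute\<close>)
qed

text \<open>Prime because the values lie in an integral domain.\<close>
lemma evaluation_kernel_prime:
  fixes h :: "'a::comm_ring_1 \<Rightarrow> 'b::idom"
  assumes h: "coeff_hom h"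
  shows "primeideal {f \<in> carrier (poly_ring s). hom_eval h \<alpha> f = 0} (poly_ring s)"
    (is "primeideal ?J _")
proof (rule primeidealI)
  have um: "hom_eval h \<alpha> (- p) = - hom_eval h \<alpha> p" for p
    using hom_eval_diff[OF h, of \<alpha> 0 p] by simp
  show "ideal ?J (poly_ring s)"
  proof (rule poly_ring_idealI)
    show "- p \<in> ?J" if "p \<in> ?J" for p
      using that poly_ring_uminus_closed[of p s] by (simp add: um)
  qed (auto simp: poly_ring_closed hom_eval_add[OF h] hom_eval_mult[OF h])
  show "cring (poly_ring s :: 'a mpoly ring)" by (rule poly_ring_cring)
  have "1 \<notin> ?J" using h by simp
  then show "carrier (poly_ring s) \<noteq> ?J" using zero_one_carrier(2) by metis
qed (auto simp: hom_eval_mult[OF h])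

lemma vanishing_ideal_ideal: "ideal (vanishing_ideal s X) (poly_ring s)"
proof -
  interpret cring "poly_ring s :: 'a mpoly ring" by (rule poly_ring_cring)
  show ?thesis
    unfolding vanishing_ideal_def by (rule genideal_ideal) (auto dest: homogeneousD(1))
qed

lemma vanishing_ideal_minimal:
  fixes X :: "(nat \<Rightarrow> 'a::field) set set"
  assumes "X \<subseteq> projective_space s" "ideal J (poly_ring s)"
    and "\<And>f e. f \<in> homogeneous_polys s e \<Longrightarrow> \<forall>P\<in>X. poly_eval f (standard_rep P) = 0 \<Longrightarrow> f \<in> J"
  shows "vanishing_ideal s X \<subseteq> J"
proof -
  interpret cring "poly_ring s :: 'a mpoly ring" by (rule poly_ring_cring)
  show ?thesis
    unfolding vanishing_ideal_def
  proof (rule genideal_minimal[OF assms(2)], rule subsetI)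
    fix f assume "f \<in> {f. (\<exists>e. f \<in> homogeneous_polys s e) \<and> zero_set X f = X}"
    then obtain e where e: "f \<in> homogeneous_polys s e" "zero_set X f = X" by blast
    then have "\<forall>P\<in>X. poly_eval f (standard_rep P) = 0"
      using zero_set_rep[OF assms(1) e(1)] by blast
    then show "f \<in> J" by (rule assms(3)[OF e(1)])
  qed
qed

lemma vanishing_idealI:
  fixes X :: "(nat \<Rightarrow> 'a::field) set set"
  assumes "X \<subseteq> projective_space s" "f \<in> homogeneous_polys s e"
    and "\<And>P. P \<in> X \<Longrightarrow> poly_eval f (standard_rep P) = 0"
  shows "f \<in> vanishing_ideal s X"
proof -
  interpret cring "poly_ring s :: 'a mpoly ring" by (rule poly_ring_cring)
  have "zero_set X f = X" using assms by (auto simp: zero_set_rep)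
  moreover have "{f. (\<exists>e. f \<in> homogeneous_polys s e) \<and> zero_set X f = X} \<subseteq> vanishing_ideal s X"
    unfolding vanishing_ideal_def by (rule genideal_self) (auto dest: homogeneousD(1))
  ultimately show ?thesis using assms(2) by blast
qed

text \<open>Vanishing at a fixed representative is an ideal condition, so it passes from the homogeneous
  generators to the whole ideal, whose elements need not be homogeneous.\<close>
lemma vanishing_idealD:
  fixes X :: "(nat \<Rightarrow> 'a::field) set set"
  assumes X: "X \<subseteq> projective_space s" and f: "f \<in> vanishing_ideal s X" and P: "P \<in> X"
  shows "poly_eval f (standard_rep P) = 0"
proof -
  let ?J = "{f \<in> carrier (poly_ring s). hom_eval (\<lambda>c. c) (standard_rep P) f = 0}"
  have "vanishing_ideal s X \<subseteq> ?J"
  proof (rule vanishing_ideal_minimal[OF X])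
    show "ideal ?J (poly_ring s)"
      using evaluation_kernel_prime[OF coeff_hom_id] by (rule primeideal.axioms(1))
  qed (use P in \<open>auto simp: poly_eval_hom_eval dest: homogeneousD(1)\<close>)
  then show ?thesis using f by (auto simp: poly_eval_hom_eval)
qed

section \<open>The Hilbert function\<close>

lemma const_poly_subfield: "subfield (range const_poly) (poly_ring s :: 'a::field mpoly ring)"
proof -
  interpret cring "poly_ring s :: 'a mpoly ring" by (rule poly_ring_cring)
  let ?K = "range const_poly :: 'a mpoly set"
  have add: "const_poly a + const_poly b = const_poly (a + b)"
    and mult: "const_poly a * const_poly b = const_poly (a * b)" for a b :: 'a
    by (simp_all add: const_poly_def single_add mult_single)
  have c0: "const_poly 0 = 0" and c1: "const_poly 1 = 1" by (simp_all add: const_poly_def)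
  have inv: "\<ominus>\<^bsub>poly_ring s\<^esub> const_poly a = const_poly (- a)" for a :: 'a
    by (intro minus_equality) (simp_all add: add c0)
  have ring: "subring ?K (poly_ring s)"
    by (rule subringI) (auto simp: add mult inv simp flip: c1)
  have cring: "subcring ?K (poly_ring s)"
    by (rule subcringI[OF ring]) (auto simp: mult mult.commute)
  show ?thesis
  proof (rule subfieldI[OF cring])
    show "Units (poly_ring s\<lparr>carrier := ?K\<rparr>) = ?K - {\<zero>\<^bsub>poly_ring s\<^esub>}"
    proof (intro equalityI subsetI)
      fix p assume "p \<in> Units (poly_ring s\<lparr>carrier := ?K\<rparr>)"
      then obtain q where "p \<in> ?K" "q * p = 1" by (auto simp: Units_def)
      then show "p \<in> ?K - {\<zero>\<^bsub>poly_ring s\<^esub>}" by auto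
    next
      fix p assume "p \<in> ?K - {\<zero>\<^bsub>poly_ring s\<^esub>}"
      then obtain a where a: "p = const_poly a" "a \<noteq> 0" using c0 by auto
      then have "const_poly (inverse a) * p = 1" "p * const_poly (inverse a) = 1"
        by (simp_all add: mult c1)
      then show "p \<in> Units (poly_ring s\<lparr>carrier := ?K\<rparr>)"
        using a(1) by (auto simp: Units_def)
    qed
  qed
qed

text \<open>In degree \<open>e \<ge> |X|\<close> every point of \<open>X\<close> has a form that separates it from the others.  So
  allowing one more point of \<open>X\<close> at which forms may be non-zero raises the dimension by one.\<close>
theorem hilbert_function_points:
  fixes X :: "(nat \<Rightarrow> 'a::field) set set"
  assumes X: "X \<subseteq> projective_space s" and finX: "finite X" and ne: "X \<noteq> {}" and e: "card X \<le> e"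
  shows "hilbert_function s (vanishing_ideal s X) e = card X"
proof -
  let ?S = "poly_ring s :: 'a mpoly ring"
  let ?I = "vanishing_ideal s X"
  let ?Q = "?S Quot ?I"
  define \<pi> where "\<pi> = (\<lambda>p. ?I +>\<^bsub>?S\<^esub> p)"
  interpret S: cring ?S by (rule poly_ring_cring)
  interpret I: ideal ?I ?S by (rule vanishing_ideal_ideal)
  interpret Q: ring ?Q by (rule I.quotient_is_ring)
  interpret \<pi>: ring_hom_ring ?S ?Q \<pi> unfolding \<pi>_def by (rule I.rcos_ring_hom_ring)
  have \<pi>_eq: "\<pi> p = \<pi> q \<longleftrightarrow> p - q \<in> ?I"
    if "p \<in> carrier ?S" "q \<in> carrier ?S" for p q
    using S.quotient_eq_iff_same_a_r_cos[OF vanishing_ideal_ideal that] poly_ring_minus[OF that]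
    by (simp add: \<pi>_def)
  have \<pi>_add: "\<pi> (p + q) = \<pi> p \<oplus>\<^bsub>?Q\<^esub> \<pi> q" and \<pi>_mult: "\<pi> (p * q) = \<pi> p \<otimes>\<^bsub>?Q\<^esub> \<pi> q"
    if "p \<in> carrier ?S" "q \<in> carrier ?S" for p q
    using \<pi>.hom_add[OF that] \<pi>.hom_mult[OF that] by simp_all
  have \<pi>0: "\<pi> 0 = \<zero>\<^bsub>?Q\<^esub>" using \<pi>.hom_zero by simp
  obtain P0 where P0: "P0 \<in> X" using ne by blast
  have "1 \<notin> ?I" using vanishing_idealD[OF X _ P0, of 1] by (auto simp: poly_eval_simps)
  then have "\<one>\<^bsub>?Q\<^esub> \<noteq> \<zero>\<^bsub>?Q\<^esub>"
    using \<pi>_eq[of 1 0] \<pi>.hom_one \<pi>0 by simp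
  then have field: "subfield (\<pi> ` range const_poly) ?Q"
    by (rule \<pi>.img_is_subfield(2)[OF const_poly_subfield])
  let ?K = "\<pi> ` range const_poly"
  define V where
    "V Y = {f \<in> homogeneous_polys s e. \<forall>P\<in>X - Y. poly_eval f (standard_rep P) = 0}" for Y
  have V_carrier: "f \<in> carrier ?S" if "f \<in> V Y" for f Y
    using that homogeneousD(1) by (auto simp: V_def)
  have "Q.dimension (card Y) ?K (\<pi> ` V Y)" if "finite Y" "Y \<subseteq> X" for Y
    using that
  proof (induction Y rule: finite_induct)
    case empty
    have "\<pi> f = \<zero>\<^bsub>?Q\<^esub>" if "f \<in> V {}" for f
    proof -
      have "f \<in> ?I" using that by (auto simp: V_def intro: vanishing_idealI[OF X])
      then show ?thesis using \<pi>_eq[of f 0] V_carrier[OF that] \<pi>0 by simp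
    qed
    moreover have "0 \<in> V {}" by (simp add: V_def poly_eval_simps)
    ultimately have "\<pi> ` V {} = {\<zero>\<^bsub>?Q\<^esub>}" using \<pi>0 by force
    then show ?case by simp
  next
    case (insert P Y)
    have P: "P \<in> X" "P \<in> projective_space s" using insert.prems X by auto
    have "card (X - {P}) \<le> e" using e finX by (meson Diff_subset card_mono order_trans)
    then obtain F where F: "F \<in> homogeneous_polys s e" "poly_eval F (standard_rep P) \<noteq> 0"
        "\<forall>Q\<in>X - {P}. poly_eval F (standard_rep Q) = 0"
      using separator_of_large_degree[OF P(2), of "X - {P}" e] finX X by auto
    have FS: "F \<in> carrier ?S" using F(1) by (rule homogeneousD(1))
    have "\<pi> F \<notin> \<pi> ` V Y"
    proof
      assume "\<pi> F \<in> \<pi> ` V Y"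
      then obtain f where f: "f \<in> V Y" "\<pi> F = \<pi> f" by blast
      then have "F - f \<in> ?I" using \<pi>_eq[OF FS V_carrier[OF f(1)]] by simp
      then have "poly_eval F (standard_rep P) = poly_eval f (standard_rep P)"
        using vanishing_idealD[OF X _ P(1), of "F - f"] by (simp add: poly_eval_simps)
      then show False using f(1) P(1) insert.hyps(2) F(2) by (auto simp: V_def)
    qed
    then have dim: "Q.dimension (Suc (card Y)) ?K (Q.line_extension ?K (\<pi> F) (\<pi> ` V Y))"
      using insert by (intro Q.Suc_dim \<pi>.hom_closed FS) auto
    have "Q.line_extension ?K (\<pi> F) (\<pi> ` V Y) = \<pi> ` V (insert P Y)"
    proof (intro equalityI subsetI)
      fix u assume "u \<in> Q.line_extension ?K (\<pi> F) (\<pi> ` V Y)"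
      then obtain c f where f: "f \<in> V Y" "u = \<pi> (const_poly c) \<otimes>\<^bsub>?Q\<^esub> \<pi> F \<oplus>\<^bsub>?Q\<^esub> \<pi> f"
        by (auto simp: Q.line_extension_mem_iff)
      have "u = \<pi> (const_poly c * F + f)"
        using f(2) FS V_carrier[OF f(1)] by (simp add: \<pi>_add \<pi>_mult poly_ring_closed)
      moreover have "const_poly c * F + f \<in> V (insert P Y)"
        using f(1) F by (auto simp: V_def poly_eval_simps
            intro: homogeneous_add homogeneous_const_mult)
      ultimately show "u \<in> \<pi> ` V (insert P Y)" by blast
    next
      fix u assume "u \<in> \<pi> ` V (insert P Y)"
      then obtain g where g: "g \<in> V (insert P Y)" "u = \<pi> g" by blast
      \<comment> \<open>The multiple of \<open>F\<close> that has to be subtracted to make \<open>g\<close> vanish at \<open>P\<close> too.\<close>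
      define c where "c = poly_eval g (standard_rep P) / poly_eval F (standard_rep P)"
      define f where "f = g - const_poly c * F"
      have "poly_eval f (standard_rep Q) = 0" if "Q \<in> X - Y" for Q
        using that g(1) F by (cases "Q = P") (auto simp: V_def f_def c_def poly_eval_simps)
      then have f: "f \<in> V Y"
        using g(1) F(1) by (auto simp: V_def f_def
            intro: homogeneous_diff homogeneous_const_mult)
      have "u = \<pi> (const_poly c * F + f)" using g(2) by (simp add: f_def)
      also have "\<dots> = \<pi> (const_poly c) \<otimes>\<^bsub>?Q\<^esub> \<pi> F \<oplus>\<^bsub>?Q\<^esub> \<pi> f"
        using FS V_carrier[OF f] by (simp add: \<pi>_add \<pi>_mult poly_ring_closed)
      finally show "u \<in> Q.line_extension ?K (\<pi> F) (\<pi> ` V Y)"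
        using f by (auto simp: Q.line_extension_mem_iff)
    qed
    then show ?case using dim insert.hyps by simp
  qed
  from this[OF finX order_refl] have "Q.dimension (card X) ?K (\<pi> ` homogeneous_polys s e)"
    by (simp add: V_def)
  then have "Q.dim ?K (\<pi> ` homogeneous_polys s e) = card X"
    using Q.dimI[OF field] by (simp add: over_def)
  moreover have "?K = range (\<lambda>c. ?I +>\<^bsub>?S\<^esub> Poly_Mapping.single 0 c)"
    by (auto simp: \<pi>_def const_poly_def)
  ultimately show ?thesis
    unfolding hilbert_function_def by (simp add: \<pi>_def)
qed

section \<open>The Krull dimension of the coordinate ring\<close>

lemma poly_ring_idealD:
  fixes J :: "'a::comm_ring_1 mpoly set"
  assumes "ideal J (poly_ring s)"
  shows "p \<in> J \<Longrightarrow> p \<in> carrier (poly_ring s)"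
    and "p \<in> J \<Longrightarrow> q \<in> J \<Longrightarrow> p + q \<in> J"
    and "p \<in> J \<Longrightarrow> q \<in> J \<Longrightarrow> p - q \<in> J"
    and "p \<in> J \<Longrightarrow> r \<in> carrier (poly_ring s) \<Longrightarrow> r * p \<in> J"
proof -
  interpret ideal J "poly_ring s" by (rule assms)
  show carr: "p \<in> J \<Longrightarrow> p \<in> carrier (poly_ring s)" for p by (rule a_Hcarr)
  show add: "p \<in> J \<Longrightarrow> q \<in> J \<Longrightarrow> p + q \<in> J" for p q 
    using additive_subgroup.a_closed[OF is_additive_subgroup, of p q] by simp
  show mult: "p \<in> J \<Longrightarrow> r \<in> carrier (poly_ring s) \<Longrightarrow> r * p \<in> J" for p r
    using I_l_closed[of p r] by simp
  show "p - q \<in> J" if "p \<in> J" "q \<in> J"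
  proof -
    have "- 1 * q \<in> J" by (rule mult[OF that(2) poly_ring_uminus_closed[OF zero_one_carrier(2)]])
    from add[OF that(1) this] show ?thesis by simp
  qed
qed

lemma poly_ring_primeD:
  fixes J :: "'a::comm_ring_1 mpoly set"
  assumes "primeideal J (poly_ring s)"
  shows "1 \<notin> J"
    and "p \<in> carrier (poly_ring s) \<Longrightarrow> q \<in> carrier (poly_ring s) \<Longrightarrow> p * q \<in> J \<Longrightarrow> p \<in> J \<or> q \<in> J"
proof -
  interpret primeideal J "poly_ring s" by (rule assms)
  show "1 \<notin> J" using one_imp_carrier I_notcarr by auto
  show "p \<in> carrier (poly_ring s) \<Longrightarrow> q \<in> carrier (poly_ring s) \<Longrightarrow> p * q \<in> J \<Longrightarrow> p \<in> J \<or> q \<in> J"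
    using I_prime[of p q] by simp
qed

lemma prime_power_mem:
  fixes J :: "'a::comm_ring_1 mpoly set"
  assumes J: "primeideal J (poly_ring s)" and p: "p \<in> carrier (poly_ring s)" "p ^ k \<in> J"
  shows "p \<in> J"
proof -
  have pow: "p ^ k \<in> carrier (poly_ring s)" for k
    by (induction k) (auto intro: poly_ring_closed p)
  show ?thesis using p(2)
    by (induction k) (use poly_ring_primeD[OF J] p(1) pow in auto)
qed

lemma prime_prod_mem:
  fixes J :: "'a::comm_ring_1 mpoly set"
  assumes J: "primeideal J (poly_ring s)" and "finite S"
    and F: "\<And>x. x \<in> S \<Longrightarrow> F x \<in> carrier (poly_ring s)" and "(\<Prod>x\<in>S. F x) \<in> J"
  shows "\<exists>x\<in>S. F x \<in> J"
  using assms(2-)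
proof (induction S rule: finite_induct)
  case empty
  then show ?case using poly_ring_primeD(1)[OF J] by simp
next
  case (insert x S)
  have "(\<Prod>x\<in>S. F x) \<in> carrier (poly_ring s)"
    using insert.hyps(1) insert.prems(1)
    by (induction S rule: finite_induct) (auto intro: poly_ring_closed)
  then show ?case
    using insert poly_ring_primeD(2)[OF J, of "F x" "\<Prod>x\<in>S. F x"] by auto
qed

text \<open>The image of a univariate polynomial under \<open>K[Y] \<rightarrow> S, Y \<mapsto> T\<close>.\<close>
definition poly_subst :: "'a::comm_ring_1 mpoly \<Rightarrow> 'a poly \<Rightarrow> 'a mpoly" where
  "poly_subst T \<eta> = poly (map_poly const_poly \<eta>) T"

lemma poly_subst_0 [simp]: "poly_subst T 0 = 0"
  by (simp add: poly_subst_def)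

lemma poly_subst_pCons [simp]: "poly_subst T (pCons c \<eta>) = const_poly c + T * poly_subst T \<eta>"
  by (simp add: poly_subst_def map_poly_pCons coeff_homD[OF coeff_hom_const_poly])

lemma poly_subst_add: "poly_subst T (p + q) = poly_subst T p + poly_subst T q"
proof -
  have "map_poly const_poly (p + q) = map_poly const_poly p + map_poly const_poly q"
    by (rule poly_eqI) (simp add: coeff_map_poly coeff_homD[OF coeff_hom_const_poly])
  then show ?thesis by (simp add: poly_subst_def)
qed

lemma poly_subst_smult: "poly_subst T (smult a p) = const_poly a * poly_subst T p"
  by (induction p) (simp_all add: coeff_homD[OF coeff_hom_const_poly] algebra_simps)

lemma poly_subst_mult: "poly_subst T (p * q) = poly_subst T p * poly_subst T q"
  by (induction p)
    (simp_all add: poly_subst_add poly_subst_smult coeff_homD[OF coeff_hom_const_poly] algebra_simps)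

lemma poly_subst_1 [simp]: "poly_subst T 1 = 1"
  by (simp add: one_pCons coeff_homD[OF coeff_hom_const_poly])

lemma poly_subst_power: "poly_subst T (p ^ k) = poly_subst T p ^ k"
  by (induction k) (simp_all add: poly_subst_mult)

lemma poly_subst_diff: "poly_subst T (p - q) = poly_subst T p - poly_subst T q"
  using poly_subst_add[of T "p - q" q] by (simp add: algebra_simps)

lemma poly_subst_carrier:
  "T \<in> carrier (poly_ring s) \<Longrightarrow> poly_subst T \<eta> \<in> carrier (poly_ring s)"
  by (induction \<eta>) (auto intro: poly_ring_closed)

lemma finite_bounded_degree: "finite {p :: 'a::{zero, finite} poly. degree p \<le> n}"
proof (rule finite_subset)
  show "{p :: 'a poly. degree p \<le> n} \<subseteq> Poly ` {xs. set xs \<subseteq> UNIV \<and> length xs \<le> n + 1}"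
  proof
    fix p :: "'a poly" assume "p \<in> {p. degree p \<le> n}"
    then have "length (coeffs p) \<le> n + 1" by (simp add: length_coeffs_degree coeffs_def)
    then show "p \<in> Poly ` {xs. set xs \<subseteq> UNIV \<and> length xs \<le> n + 1}"
      by (intro image_eqI[of _ _ "coeffs p"]) auto
  qed
qed (use finite_lists_length_le[of "UNIV :: 'a set"] in auto)

text \<open>There are only finitely many residues modulo \<open>\<gamma>\<close> over a finite field.\<close>
lemma powers_congruent_mod:
  fixes \<gamma> \<eta> :: "'a::{field, finite} poly"
  assumes "\<gamma> \<noteq> 0"
  obtains a b where "a < b" "\<gamma> dvd \<eta> ^ a - \<eta> ^ b"
proof -
  have "degree (x mod \<gamma>) \<le> degree \<gamma>" for x
    using degree_mod_less[OF assms, of x] by (elim disjE) simp_all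
  then have "range (\<lambda>n::nat. \<eta> ^ n mod \<gamma>) \<subseteq> {p. degree p \<le> degree \<gamma>}" by blast
  then have "finite (range (\<lambda>n::nat. \<eta> ^ n mod \<gamma>))"
    using finite_bounded_degree finite_subset by blast
  then have "\<not> inj (\<lambda>n::nat. \<eta> ^ n mod \<gamma>)"
    using finite_imageD by fastforce
  then obtain a b :: nat where ab: "a \<noteq> b" "\<eta> ^ a mod \<gamma> = \<eta> ^ b mod \<gamma>"
    unfolding inj_def by blast
  show ?thesis
  proof (cases "a < b")
    case True
    then show ?thesis using that ab(2) by (simp add: mod_eq_dvd_iff)
  next
    case False
    then show ?thesis using that[of b a] ab(1) ab(2)[symmetric] by (simp add: mod_eq_dvd_iff)
  qed
qed

text \<open>Over a finite field, \<open>t\<^sub>i \<Prod>\<^sub>c (t\<^sub>j - c t\<^sub>i)\<close> vanishes at every rational point.  So modulo a prime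
  above the vanishing ideal all variables are multiples of a single element: the zero locus of
  the prime lies on a line.\<close>
lemma prime_over_points_line:
  fixes X :: "(nat \<Rightarrow> 'a::{field, finite}) set set"
  assumes X: "X \<subseteq> projective_space s"
    and J: "primeideal J (poly_ring s)" and sub: "vanishing_ideal s X \<subseteq> J"
  obtains T where "T \<in> carrier (poly_ring s)"
    "\<And>j. j \<in> {1..s} \<Longrightarrow> \<exists>a. var_poly j - const_poly a * T \<in> J"
proof (cases "\<exists>i\<in>{1..s}. (var_poly i :: 'a mpoly) \<notin> J")
  case True
  then obtain i where i: "i \<in> {1..s}" "(var_poly i :: 'a mpoly) \<notin> J" by blast
  have "\<exists>a. var_poly j - const_poly a * var_poly i \<in> J" if j: "j \<in> {1..s}" for j
  proof -
    let ?L = "\<lambda>a. var_poly j - const_poly a * var_poly i :: 'a mpoly"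
    have L: "?L a \<in> homogeneous_polys s 1" for a
      using i(1) j by (intro homogeneous_diff homogeneous_const_mult homogeneous_var)
    have prod: "(\<Prod>a\<in>UNIV. ?L a) \<in> homogeneous_polys s (card (UNIV :: 'a set))"
      by (rule homogeneous_prod) (rule L)
    have "var_poly i * (\<Prod>a\<in>UNIV. ?L a) \<in> vanishing_ideal s X"
    proof (rule vanishing_idealI[OF X homogeneous_mult[OF homogeneous_var[OF i(1)] prod]])
      fix P :: "(nat \<Rightarrow> 'a) set"
      let ?x = "standard_rep P"
      show "poly_eval (var_poly i * (\<Prod>a\<in>UNIV. ?L a)) ?x = 0"
      proof (cases "?x i = 0")
        case False
        then have "poly_eval (?L (?x j / ?x i)) ?x = 0" by (simp add: poly_eval_simps)
        then have "(\<Prod>a\<in>UNIV. poly_eval (?L a) ?x) = 0"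
          by (intro prod_zero) auto
        then show ?thesis by (simp add: poly_eval_simps(3) poly_eval_prod)
      qed (simp add: poly_eval_simps)
    qed
    then have "var_poly i * (\<Prod>a\<in>UNIV. ?L a) \<in> J" using sub by blast
    then have "(\<Prod>a\<in>UNIV. ?L a) \<in> J"
      using poly_ring_primeD(2)[OF J] i homogeneousD(1)[OF prod] by blast
    then show ?thesis
      using prime_prod_mem[OF J, of UNIV ?L] homogeneousD(1)[OF L] by auto
  qed
  then show ?thesis using that[of "var_poly i"] i(1) by blast
next
  \<comment> \<open>All variables lie in \<open>J\<close>: the line degenerates to the origin.\<close>
  case False
  then show ?thesis using that[of 0] by auto
qed

text \<open>Replacing every variable by its multiple of \<open>T\<close> turns \<open>h\<close> into a univariate polynomial in \<open>T\<close>
  without changing its residue class.\<close>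
lemma reduce_mod_prime:
  fixes J :: "'a::comm_ring_1 mpoly set"
  assumes J: "ideal J (poly_ring s)" and T: "T \<in> carrier (poly_ring s)"
    and line: "\<And>j. j \<in> {1..s} \<Longrightarrow> \<exists>a. var_poly j - const_poly a * T \<in> J"
    and h: "h \<in> carrier (poly_ring s)"
  shows "\<exists>\<eta>. h - poly_subst T \<eta> \<in> J"
  using h
proof (induction rule: poly_ring_induct)
  case (const c)
  have "const_poly c - poly_subst T [:c:] = 0" by simp
  moreover have "0 \<in> J" using additive_subgroup.zero_closed[OF ideal.axioms(1)[OF J]] by simp
  ultimately show ?case by metis
next
  case (var j)
  then obtain a where "var_poly j - const_poly a * T \<in> J" using line by blast
  then have "var_poly j - poly_subst T [:0, a:] \<in> J"
    by (simp add: coeff_homD[OF coeff_hom_const_poly] mult.commute)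
  then show ?case by blast
next
  case (add p q)
  then obtain \<eta> \<theta> where "p - poly_subst T \<eta> \<in> J" "q - poly_subst T \<theta> \<in> J" by blast
  then have "(p - poly_subst T \<eta>) + (q - poly_subst T \<theta>) \<in> J"
    using poly_ring_idealD(2)[OF J] by blast
  then have "p + q - poly_subst T (\<eta> + \<theta>) \<in> J"
    by (simp add: poly_subst_add algebra_simps)
  then show ?case by blast
next
  case (mult p q)
  then obtain \<eta> \<theta> where *: "p - poly_subst T \<eta> \<in> J" "q - poly_subst T \<theta> \<in> J" by blast
  have "p * (q - poly_subst T \<theta>) + poly_subst T \<theta> * (p - poly_subst T \<eta>) \<in> J"
    by (intro poly_ring_idealD(2)[OF J] poly_ring_idealD(4)[OF J] * mult.hyps
        poly_subst_carrier[OF T])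
  then have "p * q - poly_subst T (\<eta> * \<theta>) \<in> J"
    by (simp add: poly_subst_mult algebra_simps)
  then show ?case by blast
qed

text \<open>Modulo \<open>J0\<close> everything is a polynomial in \<open>T\<close>.  Since \<open>J1\<close> contains a non-zero one, the powers
  of any element repeat modulo \<open>J1\<close>, so non-zero residues modulo \<open>J1\<close> are units.\<close>
lemma no_chain_of_three_primes:
  fixes X :: "(nat \<Rightarrow> 'a::{field, finite}) set set"
  assumes X: "X \<subseteq> projective_space s" and sub: "vanishing_ideal s X \<subseteq> J0"
    and J0: "primeideal J0 (poly_ring s)" and J1: "primeideal J1 (poly_ring s)"
    and J2: "primeideal J2 (poly_ring s)"
    and "J0 \<subset> J1" "J1 \<subset> J2"
  shows False
proof -
  note id0 = primeideal.axioms(1)[OF J0] and id1 = primeideal.axioms(1)[OF J1]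
    and id2 = primeideal.axioms(1)[OF J2]
  obtain T where T: "T \<in> carrier (poly_ring s)"
      "\<And>j. j \<in> {1..s} \<Longrightarrow> \<exists>a. var_poly j - const_poly a * T \<in> J0"
    using prime_over_points_line[OF X J0 sub] by blast
  note carr = poly_subst_carrier[OF T(1)]
  obtain g where g: "g \<in> J1" "g \<notin> J0" using \<open>J0 \<subset> J1\<close> by blast
  obtain \<gamma> where \<gamma>: "g - poly_subst T \<gamma> \<in> J0"
    using reduce_mod_prime[OF id0 T poly_ring_idealD(1)[OF id1 g(1)]] by blast
  have "\<gamma> \<noteq> 0" using \<gamma> g(2) by auto
  have "g - poly_subst T \<gamma> \<in> J1" using \<gamma> \<open>J0 \<subset> J1\<close> by blast
  from poly_ring_idealD(3)[OF id1 g(1) this] have \<gamma>1: "poly_subst T \<gamma> \<in> J1" by simp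
  obtain h where h: "h \<in> J2" "h \<notin> J1" using \<open>J1 \<subset> J2\<close> by blast
  obtain \<eta> where \<eta>: "h - poly_subst T \<eta> \<in> J0"
    using reduce_mod_prime[OF id0 T poly_ring_idealD(1)[OF id2 h(1)]] by blast
  define u where "u = poly_subst T \<eta>"
  have u: "u \<in> carrier (poly_ring s)" unfolding u_def by (rule carr)
  have hu: "h - u \<in> J1" "h - u \<in> J2"
    using \<eta> \<open>J0 \<subset> J1\<close> \<open>J1 \<subset> J2\<close> by (auto simp: u_def)
  have u1: "u \<notin> J1" using poly_ring_idealD(2)[OF id1 hu(1), of u] h(2) by auto
  have u2: "u \<in> J2" using poly_ring_idealD(3)[OF id2 h(1) hu(2)] by simp
  have upow: "u ^ k \<in> carrier (poly_ring s)" for k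
    by (induction k) (auto intro: poly_ring_closed u)
  obtain a b where ab: "a < b" "\<gamma> dvd \<eta> ^ a - \<eta> ^ b"
    using powers_congruent_mod[OF \<open>\<gamma> \<noteq> 0\<close>] .
  then obtain \<theta> where "\<eta> ^ a - \<eta> ^ b = \<theta> * \<gamma>" by (metis dvdE mult.commute)
  then have "u ^ a - u ^ b = poly_subst T \<theta> * poly_subst T \<gamma>"
    unfolding u_def by (metis poly_subst_diff poly_subst_mult poly_subst_power)
  then have "u ^ a - u ^ b \<in> J1" using poly_ring_idealD(4)[OF id1 \<gamma>1 carr] by simp
  moreover have "u ^ a - u ^ b = u ^ a * (1 - u ^ (b - a))"
    using ab(1) by (simp add: algebra_simps flip: power_add)
  ultimately have "u ^ a \<in> J1 \<or> 1 - u ^ (b - a) \<in> J1"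
    using poly_ring_primeD(2)[OF J1 upow poly_ring_closed(3)[OF zero_one_carrier(2) upow]] by simp
  then have "1 - u ^ (b - a) \<in> J2"
    using prime_power_mem[OF J1 u] u1 \<open>J1 \<subset> J2\<close> by blast
  moreover have "u ^ (b - a) \<in> J2"
  proof -
    obtain k where "b - a = Suc k" using ab(1) by (metis Suc_diff_Suc)
    then show ?thesis
      using poly_ring_idealD(4)[OF id2 u2 upow[of k]] by (simp add: mult.commute)
  qed
  ultimately have "1 \<in> J2" using poly_ring_idealD(2)[OF id2] by fastforce
  then show False using poly_ring_primeD(1)[OF J2] by contradiction
qed

lemma coeff_hom_pCons: "coeff_hom (\<lambda>c. [:c:])"
  by (simp add: coeff_hom_def one_pCons)

lemma poly_hom_eval:
  "poly (hom_eval (\<lambda>c. [:c:]) \<alpha> f) z = poly_eval f (\<lambda>i. poly (\<alpha> i) z)"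
  by (simp add: hom_eval_def poly_eval_def monom_value_def poly_sum poly_prod)

text \<open>A point \<open>x\<close> of \<open>X\<close> gives the primes of the line through \<open>x\<close> and of the origin.  The first is
  the kernel of \<open>f \<mapsto> f(x\<^sub>1 T, \<dots>, x\<^sub>s T)\<close>, and a form of degree \<open>e\<close> is sent to \<open>T\<^sup>e f(x)\<close>.\<close>
lemma chain_of_two_primes:
  fixes X :: "(nat \<Rightarrow> 'a::field) set set"
  assumes X: "X \<subseteq> projective_space s" and ne: "X \<noteq> {}"
  obtains J0 J1 where "primeideal J0 (poly_ring s)" "primeideal J1 (poly_ring s)"
    "vanishing_ideal s X \<subseteq> J0" "J0 \<subset> J1"
proof -
  obtain P where P: "P \<in> X" "P \<in> projective_space s" using ne X by blast
  let ?x = "standard_rep P"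
  let ?ev = "hom_eval (\<lambda>c. [:c:]) (\<lambda>i. [:0, 1:] * [:?x i:])"
  define J0 where "J0 = {f \<in> carrier (poly_ring s). ?ev f = 0}"
  define J1 where "J1 = {f \<in> carrier (poly_ring s). hom_eval (\<lambda>c. c) (\<lambda>_. 0 :: 'a) f = 0}"
  have J0: "primeideal J0 (poly_ring s)"
    unfolding J0_def by (rule evaluation_kernel_prime[OF coeff_hom_pCons])
  have J1: "primeideal J1 (poly_ring s)"
    unfolding J1_def by (rule evaluation_kernel_prime[OF coeff_hom_id])
  have sub: "vanishing_ideal s X \<subseteq> J0"
  proof (rule vanishing_ideal_minimal[OF X primeideal.axioms(1)[OF J0]])
    fix f e assume f: "f \<in> homogeneous_polys s e" "\<forall>P\<in>X. poly_eval f (standard_rep P) = 0"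
    have "?ev f = [:0, 1:] ^ e * hom_eval (\<lambda>c. [:c:]) (\<lambda>i. [:?x i:]) f"
      by (rule hom_eval_scale[OF f(1)])
    also have "\<dots> = 0"
      using f(2) P(1) by (simp add: hom_eval_map[OF coeff_hom_pCons])
    finally show "f \<in> J0" using homogeneousD(1)[OF f(1)] by (simp add: J0_def)
  qed
  obtain i where i: "i \<in> {1..s}" "?x i \<noteq> 0"
    using nonzero_coordinate[OF standard_rep(2)[OF P(2)]] .
  have "J0 \<subseteq> J1"
  proof
    fix f assume "f \<in> J0"
    then have "f \<in> carrier (poly_ring s)" "poly (?ev f) 0 = 0" by (auto simp: J0_def)
    then show "f \<in> J1" by (simp add: poly_hom_eval J1_def poly_eval_hom_eval)
  qed
  moreover have "var_poly i \<in> J1" "var_poly i \<notin> J0"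
    using i var_poly_carrier[OF i(1)] by (auto simp: J0_def J1_def coeff_hom_id coeff_hom_pCons)
  ultimately have "J0 \<subset> J1" by blast
  then show ?thesis using that J0 J1 sub by blast
qed

text \<open>One direction of the correspondence between the primes above \<open>I\<close> and the primes of the
  quotient.  The membership criterion keeps strict inclusions strict.\<close>
lemma prime_in_quotient:
  fixes I J :: "'a::comm_ring_1 mpoly set"
  assumes I: "ideal I (poly_ring s)" and J: "primeideal J (poly_ring s)" and sub: "I \<subseteq> J"
  shows "primeideal ((\<lambda>p. I +>\<^bsub>poly_ring s\<^esub> p) ` J) (poly_ring s Quot I)"
    and "p \<in> carrier (poly_ring s) \<Longrightarrow>
      I +>\<^bsub>poly_ring s\<^esub> p \<in> (\<lambda>p. I +>\<^bsub>poly_ring s\<^esub> p) ` J \<longleftrightarrow> p \<in> J"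
proof -
  let ?S = "poly_ring s :: 'a mpoly ring"
  let ?\<pi> = "\<lambda>p. I +>\<^bsub>?S\<^esub> p"
  interpret S: cring ?S by (rule poly_ring_cring)
  interpret I: ideal I ?S by (rule I)
  interpret \<pi>: ring_hom_ring ?S "?S Quot I" ?\<pi> by (rule I.rcos_ring_hom_ring)
  note idJ = primeideal.axioms(1)[OF J]
  show mem: "?\<pi> p \<in> ?\<pi> ` J \<longleftrightarrow> p \<in> J" if p: "p \<in> carrier ?S" for p
  proof
    assume "?\<pi> p \<in> ?\<pi> ` J"
    then obtain q where q: "q \<in> J" "?\<pi> p = ?\<pi> q" by blast
    note qS = poly_ring_idealD(1)[OF idJ q(1)]
    have "p - q \<in> I"
      using S.quotient_eq_iff_same_a_r_cos[OF I p qS] q(2) poly_ring_minus[OF p qS] by simp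
    then have "p - q \<in> J" using sub by blast
    then show "p \<in> J" using poly_ring_idealD(2)[OF idJ _ q(1)] by fastforce
  qed (rule imageI)
  have surj: "\<exists>p\<in>carrier ?S. c = ?\<pi> p" if "c \<in> carrier (?S Quot I)" for c
    using that by (auto simp: FactRing_def A_RCOSETS_def')
  show "primeideal (?\<pi> ` J) (?S Quot I)"
  proof (rule primeidealI)
    show "ideal (?\<pi> ` J) (?S Quot I)" by (rule S.ring_ideal_imp_quot_ideal[OF I idJ])
    show "cring (?S Quot I)" by (rule I.quotient_is_cring[OF S.is_cring])
    have "?\<pi> 1 \<notin> ?\<pi> ` J"
      unfolding mem[OF zero_one_carrier(2)] by (rule poly_ring_primeD(1)[OF J])
    moreover have "?\<pi> 1 \<in> carrier (?S Quot I)" by (rule \<pi>.hom_closed) simp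
    ultimately show "carrier (?S Quot I) \<noteq> ?\<pi> ` J" by blast
  next
    fix a b
    assume "a \<in> carrier (?S Quot I)" "b \<in> carrier (?S Quot I)"
    then obtain p q where pq: "p \<in> carrier ?S" "q \<in> carrier ?S" and ab: "a = ?\<pi> p" "b = ?\<pi> q"
      using surj[of a] surj[of b] by auto
    have hom: "?\<pi> (p * q) = ?\<pi> p \<otimes>\<^bsub>?S Quot I\<^esub> ?\<pi> q"
      using \<pi>.hom_mult[OF pq] by simp
    assume "a \<otimes>\<^bsub>?S Quot I\<^esub> b \<in> ?\<pi> ` J"
    then have "?\<pi> (p * q) \<in> ?\<pi> ` J" unfolding ab hom .
    then have "p * q \<in> J" unfolding mem[OF poly_ring_closed(2)[OF pq]] .
    from poly_ring_primeD(2)[OF J pq this] show "a \<in> ?\<pi> ` J \<or> b \<in> ?\<pi> ` J"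
      unfolding ab mem[OF pq(1)] mem[OF pq(2)] .
  qed
qed

text \<open>A chain of primes of the quotient pulls back to a chain of primes above the vanishing ideal,
  where three terms are impossible; a point of \<open>X\<close> supplies a chain with two terms.\<close>
theorem krull_dim_points:
  fixes X :: "(nat \<Rightarrow> 'a::{field, finite}) set set"
  assumes X: "X \<subseteq> projective_space s" and ne: "X \<noteq> {}"
  shows "krull_dim (poly_ring s Quot vanishing_ideal s X) = enat 1"
proof -
  let ?S = "poly_ring s :: 'a mpoly ring"
  let ?I = "vanishing_ideal s X"
  let ?Q = "?S Quot ?I"
  let ?\<pi> = "\<lambda>p. ?I +>\<^bsub>?S\<^esub> p"
  interpret S: cring ?S by (rule poly_ring_cring)
  interpret I: ideal ?I ?S by (rule vanishing_ideal_ideal)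
  interpret \<pi>: ring_hom_ring ?S ?Q ?\<pi> by (rule I.rcos_ring_hom_ring)
  let ?chain = "\<lambda>n \<pp>. (\<forall>i\<le>n. primeideal (\<pp> i) ?Q) \<and> (\<forall>i<n. \<pp> i \<subset> \<pp> (Suc i))"
  have upper: "n \<le> 1" if chain: "?chain n \<pp>" for n :: nat and \<pp>
  proof (rule ccontr)
    assume "\<not> n \<le> 1"
    then have n: "2 \<le> n" by simp
    define J where "J i = {p \<in> carrier ?S. ?\<pi> p \<in> \<pp> i}" for i :: nat
    have prime: "primeideal (J i) ?S" if "i \<le> 2" for i
      unfolding J_def using chain n that
      by (intro \<pi>.primeideal_vimage S.is_cring) simp
    have surj: "\<exists>p\<in>carrier ?S. c = ?\<pi> p" if "c \<in> carrier ?Q" for c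
      using that by (auto simp: FactRing_def A_RCOSETS_def')
    have strict: "J i \<subset> J (Suc i)" if i: "i < 2" for i
    proof -
      have sub: "\<pp> i \<subset> \<pp> (Suc i)" using chain n i by simp
      then obtain c where c: "c \<in> \<pp> (Suc i)" "c \<notin> \<pp> i" by blast
      interpret Pi: primeideal "\<pp> (Suc i)" ?Q using chain n i by simp
      obtain p where "p \<in> carrier ?S" "c = ?\<pi> p" using surj Pi.a_Hcarr[OF c(1)] by blast
      then have "p \<in> J (Suc i)" "p \<notin> J i" using c by (simp_all add: J_def)
      moreover have "J i \<subseteq> J (Suc i)" using sub by (auto simp: J_def)
      ultimately show ?thesis by blast
    qed
    have "?I \<subseteq> J 0"
    proof
      fix p assume p: "p \<in> ?I"
      interpret P0: primeideal "\<pp> 0" ?Q using chain by simp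
      have "?\<pi> p = ?I" by (rule I.a_rcos_const[OF p])
      then have "?\<pi> p = \<zero>\<^bsub>?Q\<^esub>" by (simp add: FactRing_def)
      then show "p \<in> J 0" using I.a_Hcarr[OF p] P0.zero_closed by (simp add: J_def)
    qed
    then show False
      using no_chain_of_three_primes[OF X, of "J 0" "J 1" "J 2"] prime strict[of 0] strict[of 1]
      by (simp add: numeral_2_eq_2)
  qed
  obtain J0 J1 where J: "primeideal J0 ?S" "primeideal J1 ?S" "?I \<subseteq> J0" "J0 \<subset> J1"
    using chain_of_two_primes[OF X ne] .
  note q0 = prime_in_quotient[OF vanishing_ideal_ideal J(1,3)]
  have "?I \<subseteq> J1" using J by blast
  note q1 = prime_in_quotient[OF vanishing_ideal_ideal J(2) this]
  have strict: "?\<pi> ` J0 \<subset> ?\<pi> ` J1"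
  proof -
    obtain f where f: "f \<in> J1" "f \<notin> J0" using J(4) by blast
    have "f \<in> carrier ?S" using primeideal.axioms(1)[OF J(2)] f(1) by (rule poly_ring_idealD(1))
    then have "?\<pi> f \<notin> ?\<pi> ` J0" using f(2) by (simp only: q0(2) not_False_eq_True)
    moreover have "?\<pi> f \<in> ?\<pi> ` J1" using f(1) by (rule imageI)
    moreover have "?\<pi> ` J0 \<subseteq> ?\<pi> ` J1" using J(4) by (intro image_mono) simp
    ultimately show ?thesis by blast
  qed
  let ?\<qq> = "\<lambda>i::nat. if i = 0 then ?\<pi> ` J0 else ?\<pi> ` J1"
  have chain: "?chain 1 ?\<qq>" using q0(1) q1(1) strict by simp
  have lower: "enat 1 \<in> {enat n | n. \<exists>\<pp>. ?chain n \<pp>}"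
    by (rule CollectI, rule exI[of _ 1], rule conjI[OF refl], rule exI[of _ ?\<qq>], rule chain)
  show ?thesis
    unfolding krull_dim_def
  proof (rule antisym)
    show "Sup {enat n | n. \<exists>\<pp>. ?chain n \<pp>} \<le> enat 1"
    proof (rule Sup_least)
      fix x assume "x \<in> {enat n | n. \<exists>\<pp>. ?chain n \<pp>}"
      then have "\<exists>n. x = enat n \<and> (\<exists>\<pp>. ?chain n \<pp>)" by (rule CollectD)
      then obtain n where n: "x = enat n \<and> (\<exists>\<pp>. ?chain n \<pp>)" by (rule exE)
      from conjunct2[OF n] obtain \<pp> where "?chain n \<pp>" by (rule exE)
      from upper[OF this] show "x \<le> enat 1" using conjunct1[OF n] by simp
    qed
    show "enat 1 \<le> Sup {enat n | n. \<exists>\<pp>. ?chain n \<pp>}"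
      by (rule Sup_upper[OF lower])
  qed
qed

text \<open>The Krull dimension is one, so the degree is the limit of the Hilbert function itself, which
  equals \<open>|X|\<close> from some degree on.\<close>
theorem quotient_degree_points:
  fixes X :: "(nat \<Rightarrow> 'a::{field, finite}) set set"
  assumes X: "X \<subseteq> projective_space s" and ne: "X \<noteq> {}"
  shows "quotient_degree s (vanishing_ideal s X) = real (card X)"
proof -
  let ?H = "hilbert_function s (vanishing_ideal s X)"
  have finX: "finite X" using finite_projective_space X by (rule rev_finite_subset)
  have "eventually (\<lambda>e. real (?H e) = real (card X)) sequentially"
    using eventually_ge_at_top[of "card X"]
    by eventually_elim (simp add: hilbert_function_points[OF X finX ne])
  then have "(\<lambda>e. real (?H e)) \<longlonglongrightarrow> real (card X)" by (rule tendsto_eventually)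
  then have "lim (\<lambda>e. real (?H e)) = real (card X)" by (rule limI)
  then show ?thesis by (simp add: quotient_degree_def krull_dim_points[OF X ne])
qed

section \<open>Minimum distance and the bound\<close>

lemma min_distance_lower_bound:
  assumes "c0 \<in> C" "c0 \<noteq> (\<lambda>_. 0)"
    and "\<And>c. c \<in> C \<Longrightarrow> c \<noteq> (\<lambda>_. 0) \<Longrightarrow> b \<le> card {P. c P \<noteq> 0}"
  shows "b \<le> min_distance C"
  unfolding min_distance_def using assms by (intro cInf_greatest) auto

theorem theorem5p5:
  fixes s d :: nat and l :: int
    and A :: "nat \<Rightarrow> 'a::{field, finite} set"
    and X :: "(nat \<Rightarrow> 'a) set set"
  assumes "s \<ge> 2"
    and "nested_cartesian s A"
    and "X = projective_cartesian_set s A"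
    and "int d = (\<Sum>i = 2..s - 1. int (card (A i)) - 1) + l"
    and "1 \<le> l" and "l \<le> int (card (A 1)) - 1"
  shows "(\<forall>f \<in> homogeneous_polys s d. zero_set X f \<noteq> X \<longrightarrow>
            real (card (zero_set X f))
              \<le> quotient_degree s (vanishing_ideal s X) - real_of_int (int (card (A 1)) - l + 1))
         \<and> int (min_distance (evaluation_code s X d)) \<ge> int (card (A 1)) - l + 1
         \<and> int (card (A 1)) - l + 1 \<ge> 2"
proof -
  have zero_one: "0 \<in> A i" "1 \<in> A i" if "i \<in> {1..s}" for i
    using assms(2) that by (auto simp: nested_cartesian_def)
  have side_mono: "card (A i) \<le> card (A j)" if "1 \<le> i" "i \<le> j" "j \<le> s" for i j
    using assms(2) that by (auto simp: nested_cartesian_def)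
  have card_pos: "1 \<le> card (A i)" if "i \<in> {1..s}" for i
    using zero_one(1)[OF that] card_gt_0_iff[of "A i"] by (auto simp: Suc_le_eq)
  have X: "X \<subseteq> projective_space s" using assms(3) projective_cartesian_set_subset by blast
  have finX: "finite X" using finite_projective_space X by (rule rev_finite_subset)
  \<comment> \<open>The point \<open>[1 : 0 : \<dots> : 0]\<close>, where \<open>t\<^sub>1\<^sup>d\<close> is non-zero.  It makes the set of
    weights of non-zero codewords non-empty, so that \<open>min_distance\<close> is the smallest of them.\<close>
  define x1 where "x1 i = (if i = 1 then 1 else 0 :: 'a)" for i :: nat
  define P1 where "P1 = proj_point s x1"
  have x1: "x1 \<in> nonzero_vectors s"
    using assms(1) by (auto simp: x1_def affine_space_def fun_eq_iff)
  have x1_A: "\<forall>i\<in>{1..s}. x1 i \<in> A i" by (simp add: x1_def zero_one)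
  have P1: "P1 \<in> X"
    unfolding assms(3) projective_cartesian_set_def P1_def
    using x1 x1_A by (intro imageI) auto
  have d_pos: "d > 0"
  proof -
    have "(\<Sum>i = 2..s - 1. int (card (A i)) - 1) \<ge> 0"
    proof (rule sum_nonneg)
      fix i assume "i \<in> {2..s - 1}"
      then have "1 \<le> card (A i)" by (intro card_pos) auto
      then show "0 \<le> int (card (A i)) - 1" by simp
    qed
    then show ?thesis using assms(4,5) by linarith
  qed
  define b where "b = nat (int (card (A 1)) - l + 1)"
  have b: "int b = int (card (A 1)) - l + 1" using assms(6) by (simp add: b_def)
  have bound: "b \<le> card (X - zero_set X f)"
    if f: "f \<in> homogeneous_polys s d" and nv: "zero_set X f \<noteq> X" for f
  proof -
    obtain i where i: "i \<in> {1..s}"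
        "(\<Sum>j\<in>{1..s} - {i}. card (A j) - 1) + 2 \<le> d + card (X - zero_set X f)"
      using card_nonzeros_lower_bound[OF zero_one(1) assms(3) f d_pos nv] by blast
    let ?c = "\<lambda>j. int (card (A j)) - 1"
    have "(\<Sum>j\<in>{1..s} - {i}. int (card (A j) - 1)) = (\<Sum>j\<in>{1..s} - {i}. ?c j)"
      using card_pos by (intro sum.cong refl) (auto simp: of_nat_diff)
    then have "(\<Sum>j\<in>{1..s} - {i}. ?c j) + 2 \<le> int d + int (card (X - zero_set X f))"
      using i(2) by (simp flip: of_nat_sum)
    moreover have "(\<Sum>j\<in>{1..s}. ?c j) = ?c i + (\<Sum>j\<in>{1..s} - {i}. ?c j)"
      using i(1) by (intro sum.remove) auto
    moreover have "(\<Sum>j\<in>{1..s}. ?c j) = ?c 1 + (\<Sum>j = 2..s - 1. ?c j) + ?c s"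
    proof -
      have "{1..s} = insert 1 (insert s {2..s - 1})" using assms(1) by auto
      then show ?thesis using assms(1) by simp
    qed
    \<comment> \<open>Dropping the \<open>i\<close>-th side costs at most as much as dropping the last, largest one.\<close>
    moreover have "?c i \<le> ?c s" using side_mono[of i s] i(1) by simp
    ultimately show ?thesis using b assms(4) by linarith
  qed
  have degree_bound: "real (card (zero_set X f))
      \<le> quotient_degree s (vanishing_ideal s X) - real_of_int (int (card (A 1)) - l + 1)"
    if f: "f \<in> homogeneous_polys s d" and nv: "zero_set X f \<noteq> X" for f
  proof -
    have "zero_set X f \<subseteq> X" by (auto simp: zero_set_def)
    then have "card (X - zero_set X f) + card (zero_set X f) = card X"
      using finX by (simp add: card_Diff_subset finite_subset card_mono)
    then have "b + card (zero_set X f) \<le> card X" using bound[OF f nv] by linarith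
    moreover have "X \<noteq> {}" using P1 by blast
    ultimately show ?thesis
      unfolding quotient_degree_points[OF X \<open>X \<noteq> {}\<close>] b[symmetric] by simp
  qed
  let ?word = "\<lambda>f P. if P \<in> X then poly_eval f (standard_rep P) else 0"
  have support: "{P. ?word f P \<noteq> 0} = X - zero_set X f" if "f \<in> homogeneous_polys s d" for f
    using zero_set_rep[OF X that] by auto
  have "b \<le> min_distance (evaluation_code s X d)"
  proof (rule min_distance_lower_bound)
    let ?f = "var_poly 1 ^ d :: 'a mpoly"
    have f: "?f \<in> homogeneous_polys s d"
      using assms(1) by (intro homogeneous_power homogeneous_var) simp
    then show "?word ?f \<in> evaluation_code s X d" unfolding evaluation_code_def by blast
    have "poly_eval ?f x1 \<noteq> 0" by (simp add: poly_eval_power x1_def)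
    then have "P1 \<notin> zero_set X ?f"
      using proj_point_self[OF x1] by (auto simp: zero_set_def P1_def)
    then have "P1 \<in> {P. ?word ?f P \<noteq> 0}" using P1 unfolding support[OF f] by blast
    then have "?word ?f P1 \<noteq> 0" by (rule CollectD)
    then show "?word ?f \<noteq> (\<lambda>_. 0)" by (rule contrapos_nn) (rule fun_cong)
  next
    fix c :: "(nat \<Rightarrow> 'a) set \<Rightarrow> 'a"
    assume "c \<in> evaluation_code s X d" and c: "c \<noteq> (\<lambda>_. 0)"
    then obtain f where f: "f \<in> homogeneous_polys s d" "c = ?word f"
      unfolding evaluation_code_def by blast
    then have supp: "{P. c P \<noteq> 0} = X - zero_set X f" using support by simp
    then have "zero_set X f \<noteq> X" using c by (auto simp: fun_eq_iff)
    then show "b \<le> card {P. c P \<noteq> 0}" unfolding supp by (rule bound[OF f(1)])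
  qed
  then show ?thesis using degree_bound b assms(6) by auto
qed

end
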